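(* Let $\mathcal T$ be a locally regular supercritical cellular automaton, and let $L_p$ denote the asymptotic shape of its standard $p$-perturbation. Then for every $\varepsilon>0$ there exists a $p<1$, close enough to $1$, such that $L_p$ agrees with $L_1$ outside the $\varepsilon$-neighborhood of the set of corners of the polygon $L_1$.
   Context: Deterministic CA. Let $\mathcal N\subset\mathbf Z^2$ be a finite neighborhood with $0\in\mathcal N$, $-\mathcal N=\mathcal N$, and let $\pi_d:2^{\mathcal N}\to\{0,1\}$ satisfy the standing assumptions: monotone ($\pi_d(S_1)\le\pi_d(S_2)$ whenever $S_1\subset S_2$); $\pi_d(\varnothing)=0$; symmetric ($\pi_d(-S)=\pi_d(S)$); solidification ($\pi_d(S)=1$ whenever $0\in S$). The cellular automaton (CA) is $\mathcal T(A)=\{x\in\mathbf Z^2:\pi_d((A-x)\cap\mathcal N)=1\}$, $A\subset\mathbf Z^2$. A set $A$ fills space if $\bigcup_{t\ge0}\mathcal T^t(A)=\mathbf Z^2$. Half-spaces. $S^1$ is the set of unit vectors in $\mathbf R^2$ and $H_u^-=\{x\in\mathbf R^2:\langle x,u\rangle\le0\}$. For closed $B\subset\mathbf R^2$ let $\bar{\mathcal T}(B)=\{x\in\mathbf R^2:0\in\mathcal T((B-x)\cap\mathbf Z^2)\}$. For each $u\in S^1$ there is $w(u)\in\mathbf R$ with $\bar{\mathcal T}(H_u^-)=H_u^-+w(u)u$. The CA is supercritical if $w(u)>0$ for all $u$. Local regularity. $\mathcal T$ is locally regular if for every initial state $A_0$ (initial states are assumed to fill space) there is a constant $C$ such that for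 every sequence $A_0\subset A_1\subset\cdots$ with $A_t\subset A_{t+1}\subset\mathcal T(A_t)$, and every $t$: every $x\in A_t$ at distance at least $C$ from $A_0$ has a set $G\subset A_t$, entirely within distance $C$ of $x$, that fills space. Standard $p$-perturbation ($0<p\le1$). The random rule $\pi$ with $\pi(S)=1$ if $0\in S$, $\pi(S)=p$ if $0\notin S$ and $\pi_d(S)=1$, and $\pi(S)=0$ if $\pi_d(S)=0$. Given $A_t\subset\mathbf Z^2$, each $x\in\mathbf Z^2$ belongs to $A_{t+1}$ with probability $\pi\big(((x+\mathcal N)\cap A_t)-x\big)$, independently over all $x$ and $t$. Shape. $L_p$ is the deterministic convex set such that $A_t/t\to L_p$ almost surely in the Hausdorff metric for every finite initial set $A_0$ which fills space (it exists for $p$-perturbations of locally regular supercritical CA). $L_1=\{x\in\mathbf R^2:\langle x,u\rangle\le w(u)\text{ for all }u\in S^1\}$ is the shape of the deterministic CA, which is a polygon. *)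

theory Defs
  imports "HOL-Analysis.Analysis" "HOL-Probability.Probability"
begin

type_synonym site = "int \<times> int"
type_synonym point = "real \<times> real"

definition emb :: "site \<Rightarrow> point" where
  "emb x = (real_of_int (fst x), real_of_int (snd x))"

text \<open>A rule is a predicate on subsets of the neighborhood, \<open>True\<close> standing for the value 1.
  Its values on sets that are not contained in \<open>N\<close> are irrelevant and unconstrained.\<close>

definition ca_rule :: "site set \<Rightarrow> (site set \<Rightarrow> bool) \<Rightarrow> bool" where
  "ca_rule N \<pi>d \<longleftrightarrow>
     finite N \<and> 0 \<in> N \<and> uminus ` N = N \<and>
     (\<forall>S1 S2. S1 \<subseteq> S2 \<and> S2 \<subseteq> N \<and> \<pi>d S1 \<longrightarrow> \<pi>d S2) \<and>
     \<not> \<pi>d {} \<and>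
     (\<forall>S\<subseteq>N. \<pi>d (uminus ` S) = \<pi>d S) \<and>
     (\<forall>S\<subseteq>N. 0 \<in> S \<longrightarrow> \<pi>d S)"

definition ca_step :: "site set \<Rightarrow> (site set \<Rightarrow> bool) \<Rightarrow> site set \<Rightarrow> site set" where
  "ca_step N \<pi>d A = {x. \<pi>d ((\<lambda>y. y - x) ` A \<inter> N)}"

definition fills_space :: "site set \<Rightarrow> (site set \<Rightarrow> bool) \<Rightarrow> site set \<Rightarrow> bool" where
  "fills_space N \<pi>d A \<longleftrightarrow> (\<Union>t. (ca_step N \<pi>d ^^ t) A) = UNIV"

definition half_space :: "point \<Rightarrow> point set" where
  "half_space u = {x. x \<bullet> u \<le> 0}"

definition ca_step_real :: "site set \<Rightarrow> (site set \<Rightarrow> bool) \<Rightarrow> point set \<Rightarrow> point set" where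
  "ca_step_real N \<pi>d B = {x. 0 \<in> ca_step N \<pi>d {z. emb z \<in> (\<lambda>b. b - x) ` B}}"

text \<open>For a rule satisfying \<^const>\<open>ca_rule\<close> and a unit vector \<open>u\<close>, the number below exists
  and is unique.\<close>

definition speed :: "site set \<Rightarrow> (site set \<Rightarrow> bool) \<Rightarrow> point \<Rightarrow> real" where
  "speed N \<pi>d u =
     (THE w. ca_step_real N \<pi>d (half_space u) = (\<lambda>x. x + w *\<^sub>R u) ` half_space u)"

definition supercritical :: "site set \<Rightarrow> (site set \<Rightarrow> bool) \<Rightarrow> bool" where
  "supercritical N \<pi>d \<longleftrightarrow> (\<forall>u. norm u = 1 \<longrightarrow> speed N \<pi>d u > 0)"

text \<open>The initial state is not required to be finite, only to fill space.\<close>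

definition locally_regular :: "site set \<Rightarrow> (site set \<Rightarrow> bool) \<Rightarrow> bool" where
  "locally_regular N \<pi>d \<longleftrightarrow>
     (\<forall>A0. fills_space N \<pi>d A0 \<longrightarrow>
       (\<exists>C::real. \<forall>A :: nat \<Rightarrow> site set.
          A 0 = A0 \<and> (\<forall>t. A t \<subseteq> A (Suc t) \<and> A (Suc t) \<subseteq> ca_step N \<pi>d (A t)) \<longrightarrow>
          (\<forall>t. \<forall>x\<in>A t. infdist (emb x) (emb ` A0) \<ge> C \<longrightarrow>
             (\<exists>G\<subseteq>A t. (\<forall>y\<in>G. dist (emb x) (emb y) \<le> C) \<and> fills_space N \<pi>d G))))"

definition perturbed_rule :: "(site set \<Rightarrow> bool) \<Rightarrow> real \<Rightarrow> site set \<Rightarrow> real" where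
  "perturbed_rule \<pi>d p S = (if 0 \<in> S then 1 else if \<pi>d S then p else 0)"

text \<open>The random dynamics is realized on the space of independent random variables, uniform
  on \<open>[0,1]\<close>, one for each time and site: given \<open>A\<^sub>t\<close>, the site \<open>x\<close> joins \<open>A\<^sub>t\<^sub>+\<^sub>1\<close> iff the
  variable of \<open>(t,x)\<close> is less than the value of the random rule at \<open>x\<close>, which has
  that value as its probability.\<close>

definition noise :: "(nat \<times> site \<Rightarrow> real) measure" where
  "noise = PiM UNIV (\<lambda>_. uniform_measure lborel {0..1})"

primrec random_ca ::
  "site set \<Rightarrow> (site set \<Rightarrow> real) \<Rightarrow> site set \<Rightarrow> (nat \<times> site \<Rightarrow> real) \<Rightarrow> nat \<Rightarrow> site set"
where
  "random_ca N \<pi> A0 \<omega> 0 = A0"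
| "random_ca N \<pi> A0 \<omega> (Suc t) =
     {x. \<omega> (t, x) < \<pi> ((\<lambda>y. y - x) ` ((\<lambda>z. x + z) ` N \<inter> random_ca N \<pi> A0 \<omega> t))}"

text \<open>Convergence in the Hausdorff metric, for bounded sets.\<close>

definition hausdorff_tendsto :: "(nat \<Rightarrow> point set) \<Rightarrow> point set \<Rightarrow> bool" where
  "hausdorff_tendsto K L \<longleftrightarrow>
     (\<forall>\<epsilon>>0. \<forall>\<^sub>F t in sequentially.
        K t \<subseteq> (\<Union>y\<in>L. ball y \<epsilon>) \<and> L \<subseteq> (\<Union>y\<in>K t. ball y \<epsilon>))"

text \<open>Compactness is part of the definition because a Hausdorff limit is determined only up to
  closure.\<close>

definition asymptotic_shape ::
  "site set \<Rightarrow> (site set \<Rightarrow> bool) \<Rightarrow> real \<Rightarrow> point set \<Rightarrow> bool"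
where
  "asymptotic_shape N \<pi>d p L \<longleftrightarrow>
     compact L \<and> convex L \<and> L \<noteq> {} \<and>
     (\<forall>A0. finite A0 \<and> fills_space N \<pi>d A0 \<longrightarrow>
        (AE \<omega> in noise.
           hausdorff_tendsto
             (\<lambda>t. (\<lambda>x. (1 / real t) *\<^sub>R emb x) ` random_ca N (perturbed_rule \<pi>d p) A0 \<omega> t) L))"

definition deterministic_shape :: "site set \<Rightarrow> (site set \<Rightarrow> bool) \<Rightarrow> point set" where
  "deterministic_shape N \<pi>d = {x. \<forall>u. norm u = 1 \<longrightarrow> x \<bullet> u \<le> speed N \<pi>d u}"

definition corners :: "point set \<Rightarrow> point set" where
  "corners P = {c. c extreme_point_of P}"

definition agree_outside :: "point set \<Rightarrow> point set \<Rightarrow> point set \<Rightarrow> bool" where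
  "agree_outside U K L \<longleftrightarrow> K - U = L - U"

end

(* Comparison with high-density oriented percolation, in which the blocks are seeds that advance
   with exactly the deterministic speed w(u).

   Let u be the outer normal of an edge of L_1, and a, b two points in the relative interior of that
   edge. A large disc cut off by a long chord with normal u is a seed K: one deterministic step maps
   the lattice points of K + q onto a set containing those of K + q + a and of K + q + b, for every
   real q. Indeed <a, u> = w(u) is what the chord gains in one step, while in all other directions a
   and b are strictly slower than w, and this slack absorbs the curvature of a large disc. With noise,
   each step of this kind needs only boundedly many noise variables to be favourable, which for p close
   to 1 has probability close to 1. So with positive probability one of the seeds
   K + i a + (n - i) b, 0 <= i <= n, is occupied at time n, and L_p meets the segment [a, b].

   Since L_p is convex and contained in L_1, letting [a, b] vary over finitely many short segments
   shows that L_p contains a neighbourhood in L_1 of any point of L_1 that is not a corner; then L_1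
   without the neighbourhood of the corners is covered by compactness. *)

theory Submission
  imports Defs
begin

section \<open>Oriented percolation of high density\<close>

text \<open>Blocks at the same time share noise variables, so the percolation estimate cannot use
  independence. What survives is a joint bound: m given blocks are all bad with probability at most
  (1/32)^m. Failure of percolation is therefore traced level by level, each interval of cut sites
  being explained by bad sites one level below and shorter intervals, until only bad sites are left.
  The 1/32 is forced by this recursion: summing over the position of a bad site costs a factor 16
  (\<open>convolution_run_weight_le\<close>), and a factor 2 is carried along because an interval
  may also be closed without any bad site at its own level.

  The speed w(u) must be attained exactly, since any loss would separate L_p from the edge. This is
  why a seed has a flat side, and why finiteness of \<open>N\<close> matters: it turns closeness of
  directions into an exact inclusion of neighbour sets.

  No control of an infinite cluster is required. Convergence to L_p is almost sure and L_p is
  deterministic, so survival with probability at least 3/4 at each separate time already forces L_p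
  to meet the segment.\<close>

text \<open>The quadratic denominator makes the weights closed under convolution up to a constant, which
  pays for the choice of the positions at which a run is split.\<close>

definition run_weight :: "nat \<Rightarrow> real" where
  "run_weight l = (1 / 2) ^ l / (real l + 1)\<^sup>2"

lemma run_weight_pos: "run_weight l > 0"
  by (simp add: run_weight_def)

lemma run_weight_0 [simp]: "run_weight 0 = 1"
  by (simp add: run_weight_def)

text \<open>A cut run of length l comes from a closed run of length l + 1 one level below. The
  halving of the weight pays for the factor 2 that each closed run costs in
  \<open>prob_conf_le\<close>, so the bound reproduces itself at the next level.\<close>

lemma run_weight_Suc_le: "2 * run_weight (Suc l) \<le> run_weight l"
proof -
  have "2 * run_weight (Suc l) = (1 / 2) ^ l / (real l + 2)\<^sup>2"
    by (simp add: run_weight_def add.commute)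
  also have "\<dots> \<le> run_weight l"
    unfolding run_weight_def by (intro divide_left_mono power_mono mult_pos_pos) auto
  finally show ?thesis .
qed

lemma sum_inverse_squares_le: "n > 0 \<Longrightarrow> (\<Sum>i<n. 1 / (real i + 1)\<^sup>2) \<le> 2 - 1 / real n"
proof (induction n rule: nat_induct_non_zero)
  case (Suc n)
  have "1 / (real n + 1)\<^sup>2 \<le> 1 / (real n * (real n + 1))"
    using Suc by (intro divide_left_mono mult_pos_pos) (auto simp: power2_eq_square)
  also have "\<dots> = 1 / real n - 1 / (real n + 1)"
    using Suc by (simp add: field_simps)
  finally show ?case using Suc by (simp add: add.commute)
qed simp

text \<open>Partial fractions: with a = l + 1 and b = m - l, 1 / (a b) = (1 / a + 1 / b) / (m + 1),
  so the denominator of \<open>run_weight m\<close> splits off and the remaining squares are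
  summable. The lengths add up to m - 1, one site being spent on the bad site between the two
  pieces; this costs a factor 2 in the geometric part.\<close>

lemma convolution_run_weight_le:
  "(\<Sum>l<m. run_weight l * run_weight (m - 1 - l)) \<le> 16 * run_weight m"
proof (cases "m = 0")
  case False
  have term_le: "run_weight l * run_weight (m - 1 - l) \<le>
      4 * run_weight m * (1 / (real l + 1)\<^sup>2 + 1 / (real (m - 1 - l) + 1)\<^sup>2)" if "l < m" for l
  proof -
    define a b where "a = real l + 1" and "b = real (m - 1 - l) + 1"
    have ab: "a > 0" "b > 0" "a + b = real m + 1"
      using that by (auto simp: a_def b_def)
    have pow: "(1 / 2 :: real) ^ l * (1 / 2) ^ (m - 1 - l) = 2 * (1 / 2) ^ m"
      using that by (simp flip: power_add add: power_diff power_one_over)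
    have "1 / (a\<^sup>2 * b\<^sup>2) = (1 / a + 1 / b)\<^sup>2 / (a + b)\<^sup>2"
      using ab by (simp add: field_simps)
    also have "\<dots> \<le> 2 * (1 / a\<^sup>2 + 1 / b\<^sup>2) / (a + b)\<^sup>2"
    proof (rule divide_right_mono)
      show "(1 / a + 1 / b)\<^sup>2 \<le> 2 * (1 / a\<^sup>2 + 1 / b\<^sup>2)"
        using sum_squares_bound[of "1 / a" "1 / b"] by (simp add: power2_sum power_one_over)
    qed simp
    finally have "1 / (a\<^sup>2 * b\<^sup>2) \<le> 2 * (1 / a\<^sup>2 + 1 / b\<^sup>2) / (a + b)\<^sup>2" .
    then have "2 * (1 / 2) ^ m * (1 / (a\<^sup>2 * b\<^sup>2)) \<le>
        2 * (1 / 2) ^ m * (2 * (1 / a\<^sup>2 + 1 / b\<^sup>2) / (a + b)\<^sup>2)"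
      by (intro mult_left_mono) auto
    moreover have "run_weight l * run_weight (m - 1 - l) = 2 * (1 / 2) ^ m * (1 / (a\<^sup>2 * b\<^sup>2))"
      unfolding run_weight_def a_def b_def pow[symmetric] by simp
    moreover have "2 * (1 / 2) ^ m * (2 * x / (a + b)\<^sup>2) = 4 * run_weight m * x" for x :: real
      unfolding run_weight_def ab(3) by simp
    ultimately show ?thesis
      by (simp only: a_def b_def)
  qed
  have "(\<Sum>l<m. run_weight l * run_weight (m - 1 - l)) \<le>
      (\<Sum>l<m. 4 * run_weight m * (1 / (real l + 1)\<^sup>2 + 1 / (real (m - 1 - l) + 1)\<^sup>2))"
    by (intro sum_mono term_le) auto
  also have "\<dots> = 4 * run_weight m *
      ((\<Sum>l<m. 1 / (real l + 1)\<^sup>2) + (\<Sum>l<m. 1 / (real (m - 1 - l) + 1)\<^sup>2))"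
    unfolding sum.distrib[symmetric] sum_distrib_left ..
  also have "(\<Sum>l<m. 1 / (real (m - 1 - l) + 1)\<^sup>2) = (\<Sum>l<m. 1 / (real l + 1)\<^sup>2)"
    using sum.nat_diff_reindex[of "\<lambda>i. 1 / (real i + 1)\<^sup>2" m] by simp
  finally have "(\<Sum>l<m. run_weight l * run_weight (m - 1 - l)) \<le>
      4 * run_weight m * (2 * (\<Sum>l<m. 1 / (real l + 1)\<^sup>2))" by simp
  also have "\<dots> \<le> 4 * run_weight m * (2 * 2)"
    using sum_inverse_squares_le[of m] False run_weight_pos[of m]
    by (intro mult_left_mono) (auto intro: order_trans)
  finally show ?thesis by simp
qed (simp add: run_weight_def)

lemma sum_run_weight_le: "(\<Sum>l\<in>{1..n}. run_weight l) \<le> 1 / 4"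
proof -
  have "(\<Sum>l\<in>{1..n}. run_weight l) \<le> (\<Sum>l\<in>{1..n}. (1 / 2) ^ l / 4)"
    unfolding run_weight_def
    using power_mono[of 2 "real l + 1" 2 for l] by (intro sum_mono divide_left_mono) auto
  also have "\<dots> = (1 - (1 / 2) ^ n) / 4"
    by (induction n) (auto simp: field_simps)
  also have "\<dots> \<le> 1 / 4" by simp
  finally show ?thesis .
qed

text \<open>Only joint badness is controlled, without independence, because this is all that
  overlapping blocks provide. Sites outside \<open>{0..n}\<close> are never bad, so every run of cut
  sites has two ends.\<close>

locale percolation = prob_space M for M :: "'a measure" +
  fixes bad :: "nat \<Rightarrow> int \<Rightarrow> 'a set" and n :: nat
  assumes bad_events: "\<And>k j. bad k j \<in> events"
    and bad_empty: "\<And>k j. j < 0 \<or> int n < j \<Longrightarrow> bad k j = {}"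
    and prob_bad_le: "\<And>S. finite S \<Longrightarrow>
      prob {\<omega> \<in> space M. \<forall>(k, j)\<in>S. \<omega> \<in> bad k j} \<le> (1 / 32) ^ card S"
begin

text \<open>A site is cut at level \<open>k\<close> if no path of \<open>k\<close> good sites descends to level \<open>0\<close> from it; the site
  \<open>j\<close> of level \<open>k + 1\<close> is connected to the sites \<open>j\<close> and \<open>j + 1\<close> of level \<open>k\<close>.\<close>

primrec cut :: "nat \<Rightarrow> int \<Rightarrow> 'a set" where
  "cut 0 j = {}"
| "cut (Suc k) j = (bad k j \<union> cut k j) \<inter> (bad k (j + 1) \<union> cut k (j + 1))"

definition closed_at :: "nat \<Rightarrow> int \<Rightarrow> 'a set" where
  "closed_at k j = bad k j \<union> cut k j"

definition cut_run :: "nat \<Rightarrow> 'a \<Rightarrow> int \<times> nat \<Rightarrow> bool" where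
  "cut_run k \<omega> = (\<lambda>(a, l). (\<forall>j\<in>{a..<a + int l}. \<omega> \<in> cut k j) \<and>
     \<omega> \<notin> cut k (a - 1) \<and> \<omega> \<notin> cut k (a + int l))"

text \<open>The two ends are treated differently on purpose. When a cut run and a bad site are split
  off on the left, the rest starts next to a site that is bad but not cut; so on the left only "not
  cut" can be kept, while the right end stays maximal.\<close>

definition closed_run :: "nat \<Rightarrow> 'a \<Rightarrow> int \<times> nat \<Rightarrow> bool" where
  "closed_run k \<omega> = (\<lambda>(a, m). (\<forall>j\<in>{a..<a + int m}. \<omega> \<in> closed_at k j) \<and>
     \<omega> \<notin> cut k (a - 1) \<and> \<omega> \<notin> closed_at k (a + int m))"

text \<open>Bad sites that explain a run of level \<open>k\<close> are moved into \<open>S\<close>,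
  so during the descent \<open>S\<close> collects sites of level at least \<open>k\<close>. At level
  0 nothing is cut, only \<open>S\<close> remains, and the joint bound applies to all collected
  sites at once.\<close>

definition conf :: "nat \<Rightarrow> (nat \<times> int) set \<Rightarrow> (int \<times> nat) set \<Rightarrow> (int \<times> nat) set \<Rightarrow> 'a set" where
  "conf k S X Y = {\<omega> \<in> space M. (\<forall>(i, j)\<in>S. \<omega> \<in> bad i j) \<and>
     (\<forall>x\<in>X. cut_run k \<omega> x) \<and> (\<forall>y\<in>Y. closed_run k \<omega> y)}"

lemma cut_events [measurable]: "cut k j \<in> events"
  by (induction k arbitrary: j) (auto intro: bad_events)

lemma closed_at_events [measurable]: "closed_at k j \<in> events"
  by (auto simp: closed_at_def intro: bad_events cut_events)

lemma conf_events:
  assumes "finite S" "finite X" "finite Y"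
  shows "conf k S X Y \<in> events"
proof -
  note [measurable] = bad_events
  show ?thesis
    unfolding conf_def cut_run_def closed_run_def case_prod_beta using assms by measurable
qed

lemma cut_empty: "j < 0 \<or> int n < j \<Longrightarrow> cut k j = {}"
  by (induction k) (auto simp: bad_empty)

text \<open>The maximal closed runs are scanned from the left: such a run either consists of one cut run,
  or splits into a (possibly empty) cut run, a bad site, and a rest to which the same applies.\<close>

lemma prob_conf_le:
  assumes IH: "\<And>S X. finite S \<Longrightarrow> S \<subseteq> {k..} \<times> UNIV \<Longrightarrow> finite X \<Longrightarrow> (\<forall>(a, l)\<in>X. l > 0) \<Longrightarrow>
      prob (conf k S X {}) \<le> (1 / 32) ^ card S * (\<Prod>(a, l)\<in>X. run_weight l)"
    and "finite S" "S \<subseteq> {k..} \<times> UNIV" "finite X" "\<forall>(a, l)\<in>X. l > 0" "finite Y"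
    and "\<forall>(a, m)\<in>Y. \<forall>j\<in>{a..<a + int m}. (k, j) \<notin> S \<and> (\<forall>l. (j, l) \<notin> X)"
    and "\<forall>y\<in>Y. \<forall>y'\<in>Y. y \<noteq> y' \<longrightarrow> fst y + int (snd y) < fst y' \<or> fst y' + int (snd y') < fst y"
  shows "prob (conf k S X Y) \<le>
    (1 / 32) ^ card S * (\<Prod>(a, l)\<in>X. run_weight l) * (\<Prod>(a, m)\<in>Y. 2 * run_weight m)"
  using assms(2-)
\<comment> \<open>Counting \<open>Suc m\<close> instead of \<open>m\<close> makes the removal of an
  empty run a decrease as well.\<close>
proof (induction "\<Sum>(a, m)\<in>Y. Suc m" arbitrary: S X Y rule: less_induct)
  case less
  show ?case
  proof (cases "Y = {}")
    case True
    then show ?thesis using IH[of S X] less.prems by simp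
  next
    case False
    then obtain a m where am: "(a, m) \<in> Y" by fast
    define Y' where "Y' = Y - {(a, m)}"
    have Y': "finite Y'" "(a, m) \<notin> Y'" "Y = insert (a, m) Y'"
      using less.prems(5) am by (auto simp: Y'_def)
    define P where "P = (1 / 32 :: real) ^ card S * (\<Prod>(a, l)\<in>X. run_weight l) *
      (\<Prod>(a, m)\<in>Y'. 2 * run_weight m)"
    have P0: "P \<ge> 0"
      unfolding P_def
      by (intro mult_nonneg_nonneg prod_nonneg) (auto simp: less_imp_le run_weight_pos)
    have sep: "a + int m < a' \<or> a' + int m' < a" if "(a', m') \<in> Y'" for a' m'
      using less.prems(7) Y' that by force
    have sum_Y: "(\<Sum>(a, m)\<in>Y. Suc m) = Suc m + (\<Sum>(a, m)\<in>Y'. Suc m)"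
      using Y' by simp
    have smaller: "prob (conf k S1 X1 Y') \<le>
        (1 / 32) ^ card S1 * (\<Prod>(a, l)\<in>X1. run_weight l) * (\<Prod>(a, m)\<in>Y'. 2 * run_weight m)"
      if "finite S1" "S1 \<subseteq> {k..} \<times> UNIV" "finite X1" "\<forall>(a, l)\<in>X1. l > 0"
        "\<forall>(a, m)\<in>Y'. \<forall>j\<in>{a..<a + int m}. (k, j) \<notin> S1 \<and> (\<forall>l. (j, l) \<notin> X1)" for S1 X1
      using that less.prems(7) Y' sum_Y by (intro less.hyps) auto
    show ?thesis
    proof (cases "m = 0")
      case True
      have "prob (conf k S X Y) \<le> prob (conf k S X Y')"
        using less.prems Y' by (intro finite_measure_mono conf_events) (auto simp: conf_def)
      also have "\<dots> \<le> P"
        unfolding P_def using less.prems Y' by (intro smaller) auto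
      also have "\<dots> \<le> 2 * P" using P0 by simp
      finally show ?thesis
        using Y' True by (simp add: P_def mult_ac)
    next
      case False
      \<comment> \<open>\<open>l\<close> is the number of cut sites before the first site that is
        not cut, which is then bad. An empty cut run is left out of \<open>X\<close>, whose runs
        have positive length; this does not change the product of weights, as
        \<open>run_weight 0 = 1\<close>.\<close>
      define E where "E l = conf k (insert (k, a + int l) S) (if l = 0 then X else insert (a, l) X)
        (insert (a + int l + 1, m - 1 - l) Y')" for l
      define F where "F = conf k S (insert (a, m) X) Y'"
      have aX: "(a, l) \<notin> X" for l
        using less.prems(6) am False by force
      have aS: "(k, a + int l) \<notin> S" if "l < m" for l
        using less.prems(6) am that by force
      have sub: "conf k S X Y \<subseteq> F \<union> (\<Union>l<m. E l)"
      proof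
        fix \<omega> assume \<omega>: "\<omega> \<in> conf k S X Y"
        then have run: "closed_run k \<omega> (a, m)" and \<omega>': "\<omega> \<in> conf k S X Y'"
          using Y' by (auto simp: conf_def)
        show "\<omega> \<in> F \<union> (\<Union>l<m. E l)"
        proof (cases "\<forall>j\<in>{a..<a + int m}. \<omega> \<in> cut k j")
          case True
          then have "\<omega> \<in> F"
            using \<omega>' run by (auto simp: F_def conf_def cut_run_def closed_run_def closed_at_def)
          then show ?thesis ..
        next
          case False
          then obtain j0 where j0: "j0 \<in> {a..<a + int m}" "\<omega> \<notin> cut k j0" by blast
          define l where "l = (LEAST l. \<omega> \<notin> cut k (a + int l))"
          have ex: "\<omega> \<notin> cut k (a + int (nat (j0 - a)))" using j0 by simp
          have l1: "\<omega> \<notin> cut k (a + int l)" unfolding l_def using ex by (rule LeastI)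
          have "l \<le> nat (j0 - a)" unfolding l_def using ex by (rule Least_le)
          then have l2: "l < m" using j0 by auto
          have l3: "\<omega> \<in> cut k j" if "j \<in> {a..<a + int l}" for j
            using not_less_Least[of "nat (j - a)" "\<lambda>l. \<omega> \<notin> cut k (a + int l)"] that
            unfolding l_def[symmetric] by auto
          have l4: "\<omega> \<in> bad k (a + int l)"
            using run l1 l2 by (auto simp: closed_run_def closed_at_def)
          have "cut_run k \<omega> (a, l)"
            using l1 l3 run by (auto simp: cut_run_def closed_run_def)
          moreover have "closed_run k \<omega> (a + int l + 1, m - 1 - l)"
            using run l1 l2 by (auto simp: closed_run_def)
          ultimately have "\<omega> \<in> E l"
            using \<omega>' l4 by (auto simp: E_def conf_def)
          then show ?thesis using l2 by blast
        qed
      qed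
      have E_le: "prob (E l) \<le> P * (1 / 16 * (run_weight l * run_weight (m - 1 - l)))"
        if l: "l < m" for l
      proof -
        let ?S = "insert (k, a + int l) S" and ?X = "if l = 0 then X else insert (a, l) X"
          and ?Y = "insert (a + int l + 1, m - 1 - l) Y'"
        have new: "(a + int l + 1, m - 1 - l) \<notin> Y'"
          using sep[of "a + int l + 1" "m - 1 - l"] l by auto
        have "prob (E l) \<le>
          (1 / 32) ^ card ?S * (\<Prod>(a, l)\<in>?X. run_weight l) * (\<Prod>(a, m)\<in>?Y. 2 * run_weight m)"
          unfolding E_def
        proof (rule less.hyps)
          show "(\<Sum>(a, m)\<in>?Y. Suc m) < (\<Sum>(a, m)\<in>Y. Suc m)"
            using new Y' l sum_Y by simp
          show "\<forall>(a, m)\<in>?Y. \<forall>j\<in>{a..<a + int m}. (k, j) \<notin> ?S \<and> (\<forall>l. (j, l) \<notin> ?X)"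
          proof (clarify, intro conjI allI)
            fix a' m' j l'
            assume *: "(a', m') \<in> ?Y" "j \<in> {a'..<a' + int m'}"
            then consider "j > a + int l" "j < a + int m" | "(a', m') \<in> Y'" "j \<noteq> a" "j \<noteq> a + int l"
              using l sep[of a' m'] by (cases "(a', m') \<in> Y'") auto
            then have "(k, j) \<notin> ?S \<and> (j, l') \<notin> ?X"
            proof cases
              case 1
              then have "j \<in> {a..<a + int m}" by simp
              then show ?thesis using less.prems(6) am 1 by auto
            next
              case 2
              then show ?thesis using less.prems(6) Y' *(2) by auto
            qed
            then show "(k, j) \<notin> ?S" "(j, l') \<notin> ?X" by auto
          qed
          show "\<forall>y\<in>?Y. \<forall>y'\<in>?Y. y \<noteq> y' \<longrightarrow>
              fst y + int (snd y) < fst y' \<or> fst y' + int (snd y') < fst y"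
            using less.prems(7) Y' sep l by force
        qed (use less.prems Y' l in auto)
        also have "(\<Prod>(a, l)\<in>?X. run_weight l) = run_weight l * (\<Prod>(a, l)\<in>X. run_weight l)"
          using aX less.prems by simp
        also have "(\<Prod>(a, m)\<in>?Y. 2 * run_weight m) =
            2 * run_weight (m - 1 - l) * (\<Prod>(a, m)\<in>Y'. 2 * run_weight m)"
          using new Y' by simp
        also have "card ?S = Suc (card S)"
          using aS[OF l] less.prems by simp
        finally show ?thesis by (simp add: P_def mult_ac)
      qed
      have F_le: "prob F \<le> P * run_weight m"
      proof -
        have "prob F \<le> (1 / 32) ^ card S * (\<Prod>(a, l)\<in>insert (a, m) X. run_weight l) *
          (\<Prod>(a, m)\<in>Y'. 2 * run_weight m)"
          unfolding F_def
        proof (rule smaller)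
          show "\<forall>(a', m')\<in>Y'. \<forall>j\<in>{a'..<a' + int m'}. (k, j) \<notin> S \<and> (\<forall>l. (j, l) \<notin> insert (a, m) X)"
            using less.prems(6) Y' sep by fastforce
        qed (use less.prems False in auto)
        then show ?thesis using aX less.prems by (simp add: P_def mult_ac)
      qed
      have ev: "F \<in> events" "\<And>l. E l \<in> events"
        unfolding F_def E_def using less.prems Y' by (auto intro!: conf_events)
      have "prob (conf k S X Y) \<le> prob (F \<union> (\<Union>l<m. E l))"
        using sub ev by (intro finite_measure_mono) auto
      also have "\<dots> \<le> prob F + prob (\<Union>l<m. E l)"
        using ev by (intro measure_Un_le) auto
      also have "prob (\<Union>l<m. E l) \<le> (\<Sum>l<m. prob (E l))"
        using ev by (intro finite_measure_subadditive_finite) auto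
      also have "prob F + (\<Sum>l<m. prob (E l)) \<le>
          P * run_weight m + (\<Sum>l<m. P * (1 / 16 * (run_weight l * run_weight (m - 1 - l))))"
        using F_le E_le by (intro add_mono sum_mono) auto
      also have "\<dots> = P * (run_weight m +
          1 / 16 * (\<Sum>l<m. run_weight l * run_weight (m - 1 - l)))"
        by (simp add: distrib_left sum_distrib_left mult_ac)
      \<comment> \<open>The new bad site gives 1/32 and the remaining closed run a factor 2, hence
        1/16, which cancels the convolution constant 16. The splittings thus cost one
        \<open>run_weight m\<close>, and the run that is entirely cut the other.\<close>
      also have "\<dots> \<le> P * (2 * run_weight m)"
        using convolution_run_weight_le[of m] by (intro mult_left_mono P0) auto
      finally show ?thesis
        using Y' by (simp add: P_def mult_ac)
    qed
  qed
qed

text \<open>Consecutive sites share a lower neighbour, so l cut sites rest on l + 1 closed ones. For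
  l > 0 the outermost of these are known to be closed; since the sites beside the run are not cut,
  their other lower neighbours must be open, which makes the run below maximal.\<close>

lemma closed_run_of_cut_run:
  assumes "cut_run (Suc k) \<omega> (a, l)" "l > 0"
  shows "closed_run k \<omega> (a, Suc l)" "\<omega> \<notin> closed_at k (a - 1)"
proof -
  have c: "\<omega> \<in> closed_at k j" "\<omega> \<in> closed_at k (j + 1)" if "j \<in> {a..<a + int l}" for j
    using assms that by (auto simp: cut_run_def closed_at_def)
  have 1: "\<omega> \<in> closed_at k j" if "j \<in> {a..<a + int (Suc l)}" for j
    using c(1)[of j] c(2)[of "j - 1"] that assms(2) by (cases "j = a") auto
  have "\<omega> \<in> closed_at k a" "\<omega> \<in> closed_at k (a + int l)"
    using 1 by auto
  then show 2: "\<omega> \<notin> closed_at k (a - 1)"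
    using assms(1) by (auto simp: cut_run_def closed_at_def)
  have "\<omega> \<notin> closed_at k (a + int l + 1)"
    using assms(1) \<open>\<omega> \<in> closed_at k (a + int l)\<close> by (auto simp: cut_run_def closed_at_def)
  then show "closed_run k \<omega> (a, Suc l)"
    using 1 2 by (auto simp: closed_run_def closed_at_def add_ac)
qed

lemma prob_cut_runs_le:
  assumes "finite S" "S \<subseteq> {k..} \<times> UNIV" "finite X" "\<forall>(a, l)\<in>X. l > 0"
  shows "prob (conf k S X {}) \<le> (1 / 32) ^ card S * (\<Prod>(a, l)\<in>X. run_weight l)"
  using assms
proof (induction k arbitrary: S X)
  case 0
  show ?case
  proof (cases "X = {}")
    case True
    then show ?thesis using prob_bad_le[OF 0(1)] by (simp add: conf_def)
  next
    case False
    then obtain a l where "(a, l) \<in> X" by fast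
    then have "\<omega> \<notin> conf 0 S X {}" for \<omega>
      using 0(4) by (fastforce simp: conf_def cut_run_def)
    then have "conf 0 S X {} = {}" by blast
    then show ?thesis
      by (auto intro!: mult_nonneg_nonneg prod_nonneg simp: less_imp_le run_weight_pos)
  qed
next
  case (Suc k)
  define Y where "Y = (\<lambda>(a, l). (a, Suc l)) ` X"
  have sub: "conf (Suc k) S X {} \<subseteq> conf k S {} Y"
    using Suc.prems(4) closed_run_of_cut_run(1) by (auto simp: conf_def Y_def)
  have pos: "0 \<le> (1 / 32 :: real) ^ card S * (\<Prod>(a, l)\<in>X. run_weight l)"
    by (auto intro!: mult_nonneg_nonneg prod_nonneg simp: less_imp_le run_weight_pos)
  show ?case
  proof (cases "\<forall>y\<in>Y. \<forall>y'\<in>Y. y \<noteq> y' \<longrightarrow>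
      fst y + int (snd y) < fst y' \<or> fst y' + int (snd y') < fst y")
    case True
    have "prob (conf (Suc k) S X {}) \<le> prob (conf k S {} Y)"
      using sub Suc.prems by (intro finite_measure_mono conf_events) (auto simp: Y_def)
    also have "\<dots> \<le> (1 / 32) ^ card S * (\<Prod>(a, l)\<in>({} :: (int \<times> nat) set). run_weight l) *
        (\<Prod>(a, m)\<in>Y. 2 * run_weight m)"
      using Suc.prems True by (intro prob_conf_le Suc.IH) (auto simp: Y_def)
    also have "(\<Prod>(a, m)\<in>Y. 2 * run_weight m) = (\<Prod>(a, l)\<in>X. 2 * run_weight (Suc l))"
      unfolding Y_def by (subst prod.reindex) (auto simp: inj_on_def case_prod_beta)
    also have "\<dots> \<le> (\<Prod>(a, l)\<in>X. run_weight l)"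
      using run_weight_Suc_le by (intro prod_mono) (auto simp: less_imp_le run_weight_pos)
    finally show ?thesis by (simp add: mult_left_mono)
  next
    case False
    then obtain a l a' l' where *: "(a, l) \<in> X" "(a', l') \<in> X" "(a, l) \<noteq> (a', l')"
      "a' \<le> a + int l + 1" "a \<le> a' + int l' + 1"
      unfolding Y_def by (fastforce simp: not_less add_ac)
    \<comment> \<open>Two different maximal closed runs can neither overlap nor touch, so prescribed
      runs without a gap below them describe an empty event.\<close>
    have "\<omega> \<notin> conf (Suc k) S X {}" for \<omega>
    proof
      assume "\<omega> \<in> conf (Suc k) S X {}"
      then have runs: "closed_run k \<omega> (a, Suc l)" "\<omega> \<notin> closed_at k (a - 1)"
        "closed_run k \<omega> (a', Suc l')" "\<omega> \<notin> closed_at k (a' - 1)"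
        using closed_run_of_cut_run[of k \<omega> a l] closed_run_of_cut_run[of k \<omega> a' l']
          * Suc.prems(4) by (auto simp: conf_def)
      consider "a < a'" | "a' < a" | "a = a'" "l < l'" | "a = a'" "l' < l"
        using *(3) by fastforce
      then show False
      proof cases
        case 1
        then have "\<omega> \<in> closed_at k (a' - 1)"
          using runs(1) *(4) by (auto simp: closed_run_def)
        then show ?thesis using runs(4) by simp
      next
        case 2
        then have "\<omega> \<in> closed_at k (a - 1)"
          using runs(3) *(5) by (auto simp: closed_run_def)
        then show ?thesis using runs(2) by simp
      qed (use runs(1,3) in \<open>auto simp: closed_run_def\<close>)
    qed
    then have "conf (Suc k) S X {} = {}" by blast
    then show ?thesis using pos by simp
  qed
qed

text \<open>If site 0 is cut, then it starts a maximal cut run, because site -1 never is; summing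
  over its length gives a bound that depends neither on \<open>k\<close> nor on
  \<open>n\<close>.\<close>

lemma prob_cut_le: "prob (cut k 0) \<le> 1 / 4"
proof -
  have sub: "cut k 0 \<subseteq> (\<Union>l\<in>{1..n + 1}. conf k {} {(0, l)} {})"
  proof
    fix \<omega> assume \<omega>: "\<omega> \<in> cut k 0"
    define l where "l = (LEAST l. \<omega> \<notin> cut k (int l))"
    have ex: "\<omega> \<notin> cut k (int (n + 1))" using cut_empty[of "int (n + 1)"] by simp
    have l1: "\<omega> \<notin> cut k (int l)" unfolding l_def using ex by (rule LeastI)
    have l2: "l \<le> n + 1" unfolding l_def using ex by (rule Least_le)
    have l3: "\<omega> \<in> cut k j" if "j \<in> {0..<int l}" for j
      using not_less_Least[of "nat j" "\<lambda>l. \<omega> \<notin> cut k (int l)"] that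
      unfolding l_def[symmetric] by auto
    have "l \<noteq> 0" using \<omega> l1 by (intro notI) auto
    moreover have "\<omega> \<in> conf k {} {(0, l)} {}"
      using l1 l3 \<omega> sets.sets_into_space[OF cut_events] cut_empty[of "-1"]
      by (auto simp: conf_def cut_run_def)
    ultimately show "\<omega> \<in> (\<Union>l\<in>{1..n + 1}. conf k {} {(0, l)} {})"
      using l2 by force
  qed
  have "prob (cut k 0) \<le> prob (\<Union>l\<in>{1..n + 1}. conf k {} {(0, l)} {})"
    using sub by (intro finite_measure_mono) (auto intro!: conf_events)
  also have "\<dots> \<le> (\<Sum>l\<in>{1..n + 1}. prob (conf k {} {(0, l)} {}))"
    by (intro finite_measure_subadditive_finite) (auto intro!: conf_events)
  also have "\<dots> \<le> (\<Sum>l\<in>{1..n + 1}. run_weight l)"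
    using prob_cut_runs_le[of "{}" k "{(0, l)}" for l] by (intro sum_mono) auto
  also have "\<dots> \<le> 1 / 4" by (rule sum_run_weight_le)
  finally show ?thesis .
qed

end

section \<open>The noise\<close>

text \<open>The limit superior of the events has probability at least \<open>c\<close>, by
  continuity from above along the unions of tails. No relation between events of different times
  enters.\<close>

lemma (in prob_space) not_AE_eventually_notin:
  assumes E: "\<And>n :: nat. E n \<in> events" and c: "c > 0" "\<And>n. c \<le> prob (E n)"
  shows "\<not> (AE \<omega> in M. \<forall>\<^sub>F n in sequentially. \<omega> \<notin> E n)"
proof
  assume AE: "AE \<omega> in M. \<forall>\<^sub>F n in sequentially. \<omega> \<notin> E n"
  define B where "B m = (\<Union>n\<in>{m..}. E n)" for m
  have B: "B m \<in> events" for m using E by (auto simp: B_def)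
  have "AE \<omega> in M. \<omega> \<notin> (\<Inter>m. B m)"
    using AE by eventually_elim (auto simp: B_def eventually_sequentially)
  then have "(\<Inter>m. B m) \<in> null_sets M"
    using B by (subst AE_iff_null_sets) auto
  then have "prob (\<Inter>m. B m) = 0" by (simp add: measure_eq_0_null_sets)
  moreover have "(\<lambda>m. prob (B m)) \<longlonglongrightarrow> prob (\<Inter>m. B m)"
    using B by (intro finite_Lim_measure_decseq) (fastforce simp: decseq_def B_def)+
  moreover have "c \<le> prob (B m)" for m
  proof -
    have "prob (E m) \<le> prob (B m)" using B by (intro finite_measure_mono) (auto simp: B_def)
    then show ?thesis using c(2)[of m] by simp
  qed
  ultimately show False
    using c(1) by (metis LIMSEQ_le_const not_less)
qed

interpretation noise: product_prob_space "\<lambda>_ :: nat \<times> site. uniform_measure lborel {0..1 :: real}" UNIV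
  rewrites "PiM UNIV (\<lambda>_ :: nat \<times> site. uniform_measure lborel {0..1 :: real}) = noise"
  by (intro product_prob_spaceI prob_space_uniform_measure) (auto simp: noise_def)

lemma space_noise [simp]: "space noise = UNIV"
  by (simp add: noise_def space_PiM)

lemma measurable_noise_component [measurable]: "(\<lambda>\<omega>. \<omega> s) \<in> borel_measurable noise"
proof -
  have "(\<lambda>\<omega>. \<omega> s) \<in> measurable noise (uniform_measure lborel {0..1})"
    unfolding noise_def by (rule measurable_component_singleton) simp
  then show ?thesis
    by (rule measurable_cong_sets[THEN equalityD1, THEN subsetD, rotated 2]) auto
qed

lemma prob_noise_ge:
  assumes "finite F" "0 \<le> p" "p \<le> 1"
  shows "measure noise {\<omega>. \<forall>s\<in>F. p \<le> \<omega> s} = (1 - p) ^ card F"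
proof -
  have "{\<omega>. \<forall>s\<in>F. p \<le> \<omega> s} =
      prod_emb UNIV (\<lambda>_ :: nat \<times> site. uniform_measure lborel {0..1 :: real}) F (Pi\<^sub>E F (\<lambda>_. {p..}))"
    by (auto simp: prod_emb_def PiE_iff)
  then have "measure noise {\<omega>. \<forall>s\<in>F. p \<le> \<omega> s} =
      (\<Prod>s\<in>F. measure (uniform_measure lborel {0..1 :: real}) {p..})"
    using assms by (simp add: noise.measure_PiM_emb)
  also have "measure (uniform_measure lborel {0..1 :: real}) {p..} = 1 - p"
  proof -
    have "{0..1} \<inter> {p..} = {p..1}" using assms by auto
    then show ?thesis using assms by (subst measure_uniform_measure) auto
  qed
  finally show ?thesis by simp
qed

text \<open>A negative variable would let a site join even where the random rule has value 0; almost
  surely this does not happen at any of the countably many times and sites.\<close>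

lemma AE_noise_nonneg: "AE \<omega> in noise. \<forall>s. 0 \<le> \<omega> s"
proof -
  have "AE x in uniform_measure lborel {0..1 :: real}. 0 \<le> x"
    by (intro AE_uniform_measureI) auto
  then show ?thesis
    by (simp add: AE_all_countable noise.AE_component)
qed

text \<open>A set of blocks contains a proportion of at least \<open>1 / d\<close> of blocks whose positions agree modulo \<open>d\<close>;
  these depend on disjoint parts of the noise.\<close>

lemma prob_all_bad_le:
  fixes B :: "nat \<Rightarrow> int \<Rightarrow> site set"
  assumes S: "finite (S :: (nat \<times> int) set)" and p: "0 \<le> p" "p \<le> 1"
    and d: "d > 0"
    and fin: "\<And>k j. finite (B k j)" and V: "\<And>k j. card (B k j) \<le> V"
    and disj: "\<And>k i j. int d \<le> \<bar>i - j\<bar> \<Longrightarrow> B k i \<inter> B k j = {}"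
    and q: "0 \<le> q" "q \<le> 1" "real V * (1 - p) \<le> q ^ d"
  shows "measure noise {\<omega>. \<forall>(k, j)\<in>S. \<exists>x\<in>B k j. p \<le> \<omega> (k, x)} \<le> q ^ card S"
proof -
  have "\<exists>c\<in>{0..<int d}. card ((\<lambda>s. snd s mod int d) -` {c} \<inter> S) * card {0..<int d} \<ge> card S"
    by (intro pigeonhole_card S) (use d in auto)
  then obtain c where c: "card S \<le> card ((\<lambda>s. snd s mod int d) -` {c} \<inter> S) * d"
    by auto
  define S' where "S' = (\<lambda>s. snd s mod int d) -` {c} \<inter> S"
  have S': "finite S'" "S' \<subseteq> S" using S by (auto simp: S'_def)
  have far: "int d \<le> \<bar>i - j\<bar>" if "(k, i) \<in> S'" "(k, j) \<in> S'" "i \<noteq> j" for k i j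
  proof -
    have "i mod int d = j mod int d" using that by (simp add: S'_def)
    then have "int d dvd i - j" by (simp add: mod_eq_dvd_iff)
    then show ?thesis using that(3) dvd_imp_le_int[of "i - j" "int d"] by simp
  qed
  \<comment> \<open>A union bound over all ways to name one unfavourable noise variable in each
    block of \<open>S'\<close>.\<close>
  define P where "P = Pi\<^sub>E S' (\<lambda>s. B (fst s) (snd s))"
  have P: "finite P" unfolding P_def using S' fin by (intro finite_PiE) auto
  define E where "E f = {\<omega> :: nat \<times> site \<Rightarrow> real. \<forall>s\<in>(\<lambda>s. (fst s, f s)) ` S'. p \<le> \<omega> s}" for f
  have E: "E f \<in> sets noise" for f
  proof -
    have "{\<omega> \<in> space noise. \<forall>s\<in>(\<lambda>s. (fst s, f s)) ` S'. p \<le> \<omega> s} \<in> sets noise"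
      using S' by measurable
    then show ?thesis by (simp add: E_def)
  qed
  have prob_E: "measure noise (E f) = (1 - p) ^ card S'" if "f \<in> P" for f
  proof -
    \<comment> \<open>Blocks of one time with different positions in \<open>S'\<close> are at least
      \<open>d\<close> apart, hence disjoint; so the named variables are distinct and therefore
      independent.\<close>
    have "inj_on (\<lambda>s. (fst s, f s)) S'"
    proof (rule inj_onI)
      fix s t assume st: "s \<in> S'" "t \<in> S'" "(fst s, f s) = (fst t, f t)"
      obtain k i j where s: "s = (k, i)" and t: "t = (k, j)" using st(3) by (cases s; cases t) auto
      have "f s \<in> B k i" "f s \<in> B k j" using that st s t unfolding P_def by (auto dest: PiE_mem)
      then have "\<not> int d \<le> \<bar>i - j\<bar>" using disj by blast
      then show "s = t" using far[of k i j] st s t by auto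
    qed
    then show ?thesis
      unfolding E_def using S' p by (subst prob_noise_ge) (auto simp: card_image)
  qed
  have "{\<omega>. \<forall>(k, j)\<in>S. \<exists>x\<in>B k j. p \<le> \<omega> (k, x)} \<subseteq> (\<Union>f\<in>P. E f)"
  proof
    fix \<omega> :: "nat \<times> site \<Rightarrow> real" assume "\<omega> \<in> {\<omega>. \<forall>(k, j)\<in>S. \<exists>x\<in>B k j. p \<le> \<omega> (k, x)}"
    then have "\<forall>s\<in>S'. \<exists>x. x \<in> B (fst s) (snd s) \<and> p \<le> \<omega> (fst s, x)"
      using S'(2) by fastforce
    then obtain f where f: "\<And>s. s \<in> S' \<Longrightarrow> f s \<in> B (fst s) (snd s) \<and> p \<le> \<omega> (fst s, f s)"
      by metis
    then have "restrict f S' \<in> P" "\<omega> \<in> E (restrict f S')" by (auto simp: P_def E_def)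
    then show "\<omega> \<in> (\<Union>f\<in>P. E f)" by blast
  qed
  then have "measure noise {\<omega>. \<forall>(k, j)\<in>S. \<exists>x\<in>B k j. p \<le> \<omega> (k, x)} \<le> measure noise (\<Union>f\<in>P. E f)"
    using P E by (intro noise.finite_measure_mono) auto
  also have "\<dots> \<le> (\<Sum>f\<in>P. measure noise (E f))"
    using P E by (intro noise.finite_measure_subadditive_finite) auto
  also have "\<dots> = real (card P) * (1 - p) ^ card S'"
    using prob_E by simp
  also have "\<dots> \<le> real V ^ card S' * (1 - p) ^ card S'"
  proof (rule mult_right_mono)
    have "card P \<le> V ^ card S'"
      unfolding P_def using S' V prod_mono[of S' "\<lambda>s. card (B (fst s) (snd s))" "\<lambda>_. V"]
      by (simp add: card_PiE)
    then show "real (card P) \<le> real V ^ card S'" by (metis of_nat_le_iff of_nat_power)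
  qed (use p in simp)
  also have "\<dots> \<le> (q ^ d) ^ card S'"
    unfolding power_mult_distrib[symmetric] using p q by (intro power_mono) auto
  \<comment> \<open>Here \<open>card S \<le> d * card S'\<close>: the loss from keeping a single
    residue class is why the hypothesis asks for \<open>q ^ d\<close>.\<close>
  also have "\<dots> \<le> q ^ card S"
    unfolding power_mult[symmetric] using c q by (intro power_decreasing) (auto simp: S'_def mult.commute)
  finally show ?thesis .
qed

section \<open>Seeds of full speed\<close>

declare split_paired_All [simp del] split_paired_Ex [simp del]

lemma emb_add: "emb (x + y) = emb x + emb y"
  by (simp add: emb_def prod_eq_iff)

text \<open>Origin of the radius 2 in \<open>cball 0 2 \<subseteq> K\<close>: every real translate
  of such a \<open>K\<close> contains a site.\<close>

lemma ex_lattice_point_near: "\<exists>x. norm (emb x - q) \<le> 2"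
proof
  let ?x = "(\<lfloor>fst q\<rfloor>, \<lfloor>snd q\<rfloor>)"
  have "norm (emb ?x - q) \<le> \<bar>fst (emb ?x - q)\<bar> + \<bar>snd (emb ?x - q)\<bar>"
    by (metis norm_Pair_le prod.collapse real_norm_def)
  also have "\<dots> \<le> 2" by (simp add: emb_def) linarith
  finally show "norm (emb ?x - q) \<le> 2" .
qed

lemma lattice_points_in_ball:
  shows finite_lattice_ball: "finite {x. norm (emb x - q) \<le> real r}"
    and card_lattice_ball_le: "card {x. norm (emb x - q) \<le> real r} \<le> (2 * r + 2)\<^sup>2"
proof -
  let ?I = "\<lambda>s. {\<lfloor>s\<rfloor> - int r .. \<lfloor>s\<rfloor> + int r + 1}"
  have sub: "{x. norm (emb x - q) \<le> real r} \<subseteq> ?I (fst q) \<times> ?I (snd q)"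
  proof
    fix x :: site assume "x \<in> {x. norm (emb x - q) \<le> real r}"
    moreover have "\<bar>fst p\<bar> \<le> norm p" "\<bar>snd p\<bar> \<le> norm p" for p :: point
      by (metis norm_fst_le norm_snd_le prod.collapse real_norm_def)+
    ultimately have *: "\<bar>fst (emb x - q)\<bar> \<le> real r" "\<bar>snd (emb x - q)\<bar> \<le> real r"
      by (meson mem_Collect_eq order_trans)+
    obtain i j where x: "x = (i, j)" by (cases x)
    have "i \<in> ?I (fst q)" "j \<in> ?I (snd q)"
      using * unfolding x by (auto simp: emb_def) linarith+
    then show "x \<in> ?I (fst q) \<times> ?I (snd q)" by (simp add: x)
  qed
  show "finite {x. norm (emb x - q) \<le> real r}"
    by (rule finite_subset[OF sub]) simp
  have "card {x. norm (emb x - q) \<le> real r} \<le> card (?I (fst q) \<times> ?I (snd q))"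
    by (intro card_mono sub) simp
  also have "\<dots> = (2 * r + 2)\<^sup>2"
    by (simp add: card_cartesian_product power2_eq_square nat_add_distrib nat_mult_distrib)
  finally show "card {x. norm (emb x - q) \<le> real r} \<le> (2 * r + 2)\<^sup>2" .
qed

section \<open>Half-space speeds as thresholds of the rule\<close>

locale solidifying_ca =
  fixes N :: "site set" and \<pi>d :: "site set \<Rightarrow> bool"
  assumes rule: "ca_rule N \<pi>d"
begin

abbreviation w :: "point \<Rightarrow> real" where "w \<equiv> speed N \<pi>d"

lemma finite_N: "finite N"
  and zero_in_N: "0 \<in> N"
  and mono_rule: "S1 \<subseteq> S2 \<Longrightarrow> S2 \<subseteq> N \<Longrightarrow> \<pi>d S1 \<Longrightarrow> \<pi>d S2"
  and rule_empty: "\<not> \<pi>d {}"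
  and solidification: "S \<subseteq> N \<Longrightarrow> 0 \<in> S \<Longrightarrow> \<pi>d S"
  using rule unfolding ca_rule_def by blast+

lemma ca_step_iff: "x \<in> ca_step N \<pi>d A \<longleftrightarrow> \<pi>d {z \<in> N. x + z \<in> A}"
proof -
  have "(\<lambda>y. y - x) ` A \<inter> N = {z \<in> N. x + z \<in> A}"
    by (auto simp: image_iff) (metis add_diff_cancel_left')
  then show ?thesis by (simp add: ca_step_def)
qed

lemma ca_step_real_iff: "x \<in> ca_step_real N \<pi>d B \<longleftrightarrow> \<pi>d {z \<in> N. x + emb z \<in> B}"
proof -
  have "{z \<in> N. 0 + z \<in> {z. emb z \<in> (\<lambda>b. b - x) ` B}} = {z \<in> N. x + emb z \<in> B}"
    by (auto simp: image_iff) (metis add_diff_cancel_left')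
  then show ?thesis by (simp add: ca_step_real_def ca_step_iff)
qed

text \<open>As s grows the set of neighbours shrinks, and it changes only at the finitely many
  values -<z, u>. It is accepted when it is all of \<open>N\<close> and rejected when it is empty,
  so the largest accepted critical value is an attained threshold; it is the unique number described
  by \<open>speed\<close>.\<close>

lemma speed_threshold:
  assumes u: "norm u = 1"
  shows "\<pi>d {z \<in> N. s + emb z \<bullet> u \<le> 0} \<longleftrightarrow> s \<le> w u"
proof -
  define T where "T = {t \<in> (\<lambda>z. - (emb z \<bullet> u)) ` N. \<pi>d {z \<in> N. emb z \<bullet> u \<le> - t}}"
  define wm where "wm = Max T"
  have fin: "finite T" using finite_N by (simp add: T_def)
  have ne: "T \<noteq> {}"
  proof -
    let ?t = "Min ((\<lambda>z. - (emb z \<bullet> u)) ` N)"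
    have "?t \<in> (\<lambda>z. - (emb z \<bullet> u)) ` N" using finite_N zero_in_N by (intro Min_in) auto
    moreover have "{z \<in> N. emb z \<bullet> u \<le> - ?t} = N"
    proof -
      have "?t \<le> - (emb z \<bullet> u)" if "z \<in> N" for z
        using that finite_N by (intro Min_le) auto
      then show ?thesis by force
    qed
    ultimately have "?t \<in> T"
      using solidification[of N] zero_in_N by (simp add: T_def)
    then show ?thesis by blast
  qed
  have wm: "\<pi>d {z \<in> N. emb z \<bullet> u \<le> - wm}"
    using Max_in[OF fin ne] by (simp add: T_def wm_def)
  have iff: "\<pi>d {z \<in> N. s + emb z \<bullet> u \<le> 0} \<longleftrightarrow> s \<le> wm" for s
  proof
    assume s: "s \<le> wm"
    show "\<pi>d {z \<in> N. s + emb z \<bullet> u \<le> 0}"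
      by (rule mono_rule[OF _ _ wm]) (use s in auto)
  next
    assume *: "\<pi>d {z \<in> N. s + emb z \<bullet> u \<le> 0}" (is "\<pi>d ?Z")
    let ?t = "Min ((\<lambda>z. - (emb z \<bullet> u)) ` ?Z)"
    have "?Z \<noteq> {}" using * rule_empty by metis
    then have t: "?t \<in> (\<lambda>z. - (emb z \<bullet> u)) ` ?Z" using finite_N by (intro Min_in) auto
    have "?t \<le> - (emb z \<bullet> u)" if "z \<in> ?Z" for z
      using that finite_N by (intro Min_le) auto
    then have "?Z \<subseteq> {z \<in> N. emb z \<bullet> u \<le> - ?t}" by force
    from mono_rule[OF this _ *] have "?t \<in> T" using t by (auto simp: T_def)
    then have "?t \<le> wm" unfolding wm_def using fin by simp
    moreover have "s \<le> ?t" using t by force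
    ultimately show "s \<le> wm" by simp
  qed
  have image: "(\<lambda>x. x + t *\<^sub>R u) ` half_space u = {x. x \<bullet> u \<le> t}" for t
  proof -
    have "x \<in> (\<lambda>x. x + t *\<^sub>R u) ` half_space u" if "x \<bullet> u \<le> t" for x
      using that u by (intro image_eqI[of _ _ "x - t *\<^sub>R u"])
        (auto simp: half_space_def inner_diff_left norm_eq_1)
    then show ?thesis using u by (auto simp: half_space_def inner_add_left norm_eq_1)
  qed
  have "ca_step_real N \<pi>d (half_space u) = {x. x \<bullet> u \<le> wm}"
    by (auto simp: ca_step_real_iff half_space_def inner_add_left iff)
  moreover have "wm = t" if "{x. x \<bullet> u \<le> wm} = {x. x \<bullet> u \<le> t}" for t
  proof -
    have "(s *\<^sub>R u) \<bullet> u = s" for s using u by (simp add: norm_eq_1)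
    then have "s \<le> wm \<longleftrightarrow> s \<le> t" for s
      using that by (metis (mono_tags, lifting) mem_Collect_eq)
    then show ?thesis by (meson order_antisym order_refl)
  qed
  ultimately have "speed N \<pi>d u = wm"
    unfolding speed_def image by (intro the_equality) auto
  then show ?thesis using iff by simp
qed

lemma rule_speed:
  assumes "norm u = 1"
  shows "\<pi>d {z \<in> N. emb z \<bullet> u \<le> - w u}"
proof -
  have "{z \<in> N. w u + emb z \<bullet> u \<le> 0} = {z \<in> N. emb z \<bullet> u \<le> - w u}" by auto
  then show ?thesis using speed_threshold[OF assms, of "w u"] by simp
qed

text \<open>If every site of S were deeper than \<open>w u\<close>, a half-space beyond the
  threshold would still contain S, and by monotonicity the rule would accept it. This is what bounds
  the growth from above.\<close>

lemma ex_inner_ge_speed: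
  assumes u: "norm u = 1" and S: "S \<subseteq> N" "\<pi>d S"
  shows "\<exists>z\<in>S. - w u \<le> emb z \<bullet> u"
proof (rule ccontr)
  assume "\<not> ?thesis"
  then have less: "w u < - (emb z \<bullet> u)" if "z \<in> S" for z using that by force
  let ?t = "Min ((\<lambda>z. - (emb z \<bullet> u)) ` S)"
  have "S \<noteq> {}" using S rule_empty by metis
  have fin: "finite S" using S finite_N finite_subset by blast
  have "?t \<in> (\<lambda>z. - (emb z \<bullet> u)) ` S" using \<open>S \<noteq> {}\<close> fin by (intro Min_in) auto
  then have "w u < ?t" using less by auto
  have "?t \<le> - (emb z \<bullet> u)" if "z \<in> S" for z
    using that fin by (intro Min_le) auto
  then have "S \<subseteq> {z \<in> N. ?t + emb z \<bullet> u \<le> 0}" using S by force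
  from mono_rule[OF this _ S(2)] have "?t \<le> w u" using speed_threshold[OF u] by auto
  then show False using \<open>w u < ?t\<close> by simp
qed

definition range_bound :: real where
  "range_bound = Max ((\<lambda>z. norm (emb z)) ` N)"

lemma norm_emb_le: "z \<in> N \<Longrightarrow> norm (emb z) \<le> range_bound"
  unfolding range_bound_def using finite_N by auto

lemma range_bound_nonneg: "0 \<le> range_bound"
  using norm_emb_le[OF zero_in_N] norm_ge_zero order_trans by blast

lemma speed_le_range: "norm u = 1 \<Longrightarrow> w u \<le> range_bound"
proof -
  assume u: "norm u = 1"
  obtain z where "z \<in> N" "emb z \<bullet> u \<le> - w u"
    using rule_speed[OF u] rule_empty by (metis (mono_tags, lifting) Collect_empty_eq)
  moreover have "- (emb z \<bullet> u) \<le> norm (emb z)"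
    using Cauchy_Schwarz_ineq2[of "emb z" u] u by auto
  ultimately show ?thesis using norm_emb_le[of z] by linarith
qed

lemma abs_inner_emb_le: "z \<in> N \<Longrightarrow> \<bar>emb z \<bullet> v\<bar> \<le> range_bound * norm v"
  using Cauchy_Schwarz_ineq2[of "emb z" v] norm_emb_le[of z]
  by (meson mult_right_mono norm_ge_zero order_trans)

text \<open>The neighbour set that realises \<open>w u\<close> contains a site at most
  \<open>w v\<close> deep in direction v; comparing both depths of this one site gives the Lipschitz
  bound.\<close>

lemma speed_diff_le:
  assumes "norm u = 1" "norm v = 1"
  shows "w u - w v \<le> range_bound * norm (u - v)"
proof -
  obtain z where z: "z \<in> N" "emb z \<bullet> u \<le> - w u" "- w v \<le> emb z \<bullet> v"
    using ex_inner_ge_speed[OF assms(2) _ rule_speed[OF assms(1)]] by auto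
  then have "w u - w v \<le> - (emb z \<bullet> (u - v))"
    by (simp add: inner_diff_right)
  also have "\<dots> \<le> range_bound * norm (u - v)"
    using abs_inner_emb_le[OF z(1), of "u - v"] by linarith
  finally show ?thesis .
qed

lemma continuous_on_speed: "continuous_on {v. norm v = 1} w"
proof (rule continuous_on_iff[THEN iffD2], intro ballI allI impI)
  fix u :: point and e :: real assume u: "u \<in> {v. norm v = 1}" and e: "e > 0"
  show "\<exists>d>0. \<forall>v\<in>{v. norm v = 1}. dist v u < d \<longrightarrow> dist (w v) (w u) < e"
  proof (intro exI conjI ballI impI)
    show "0 < e / (range_bound + 1)" using e range_bound_nonneg by simp
    fix v :: point assume v: "v \<in> {v. norm v = 1}" "dist v u < e / (range_bound + 1)"
    have "dist (w v) (w u) \<le> range_bound * dist v u"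
      using speed_diff_le[of u v] speed_diff_le[of v u] u v
      by (auto simp: dist_real_def dist_norm norm_minus_commute)
    also have "\<dots> \<le> (range_bound + 1) * dist v u" by (simp add: mult_right_mono)
    also have "\<dots> < e"
      using v range_bound_nonneg by (simp add: field_simps)
    finally show "dist (w v) (w u) < e" .
  qed
qed

lemma slack_bound:
  assumes "closed V" "\<And>v. v \<in> V \<Longrightarrow> norm v = 1 \<Longrightarrow> y \<bullet> v < w v"
  shows "\<exists>c>0. \<forall>v\<in>V. norm v = 1 \<longrightarrow> y \<bullet> v + c \<le> w v"
proof -
  let ?V = "V \<inter> {v. norm v = 1}"
  have "{v :: point. norm v = 1} = sphere 0 1" by auto
  then have "compact ?V" using assms(1) by (simp add: closed_Int_compact)
  show ?thesis
  proof (cases "?V = {}")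
    case True
    then show ?thesis by (intro exI[of _ 1]) auto
  next
    case False
    have "continuous_on ?V (\<lambda>v. w v - y \<bullet> v)"
      by (intro continuous_intros continuous_on_subset[OF continuous_on_speed]) auto
    from continuous_attains_inf[OF \<open>compact ?V\<close> False this]
    obtain v0 where v0: "v0 \<in> ?V" "\<And>v. v \<in> ?V \<Longrightarrow> w v0 - y \<bullet> v0 \<le> w v - y \<bullet> v" by blast
    show ?thesis
      using v0 assms(2)[of v0] by (intro exI[of _ "w v0 - y \<bullet> v0"]) fastforce
  qed
qed

text \<open>The finitely many positive values of <z, u> + w u have a positive minimum \<mu>. A small
  turn from u to v changes <z, u> and w too little to bridge \<mu>, so a site deep enough for v is
  exactly deep enough for u, without any loss.\<close>

lemma speed_set_near:
  assumes u: "norm u = 1"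
  shows "\<exists>\<kappa>>0. \<forall>v. norm v = 1 \<longrightarrow> 1 - \<kappa> \<le> v \<bullet> u \<longrightarrow>
    (\<forall>z\<in>N. emb z \<bullet> v \<le> - w v \<longrightarrow> emb z \<bullet> u \<le> - w u)"
proof -
  let ?D = "{t \<in> (\<lambda>z. emb z \<bullet> u + w u) ` N. t > 0}"
  define \<mu> where "\<mu> = Min (insert 1 ?D)"
  have fin: "finite ?D" using finite_N by simp
  have \<mu>: "\<mu> > 0" unfolding \<mu>_def using fin by (subst Min_gr_iff) auto
  have \<mu>_le: "\<mu> \<le> emb z \<bullet> u + w u" if "z \<in> N" "emb z \<bullet> u + w u > 0" for z
    unfolding \<mu>_def using fin that by (intro Min_le) auto
  \<comment> \<open>Inner product and speed each change by at most
    \<open>range_bound * \<delta>\<close>, so \<delta> has to make twice this smaller than \<mu>.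
    For unit vectors |v - u|^2 = 2 - 2 <v, u>, which turns the distance \<delta> into the angular
    bound \<delta>^2 / 2.\<close>
  define \<delta> where "\<delta> = \<mu> / (2 * range_bound + 1)"
  have \<delta>: "\<delta> > 0" using \<mu> range_bound_nonneg by (simp add: \<delta>_def)
  show ?thesis
  proof (intro exI[of _ "\<delta>\<^sup>2 / 2"] conjI allI impI ballI)
    show "\<delta>\<^sup>2 / 2 > 0" using \<delta> by simp
    fix v z assume v: "norm v = 1" "1 - \<delta>\<^sup>2 / 2 \<le> v \<bullet> u" and z: "z \<in> N" "emb z \<bullet> v \<le> - w v"
    have "(norm (v - u))\<^sup>2 = 2 - 2 * (v \<bullet> u)"
      using u v(1) unfolding power2_norm_eq_inner norm_eq_1
      by (simp add: inner_diff_left inner_diff_right inner_commute)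
    then have "(norm (v - u))\<^sup>2 \<le> \<delta>\<^sup>2" using v(2) by linarith
    then have d: "norm (v - u) \<le> \<delta>" by (rule power2_le_imp_le) (use \<delta> in simp)
    have "emb z \<bullet> u + w u \<le> (emb z \<bullet> v + w v) + 2 * (range_bound * norm (v - u))"
      using speed_diff_le[OF u v(1)] abs_inner_emb_le[OF z(1), of "v - u"]
      by (simp add: inner_diff_right norm_minus_commute)
    also have "\<dots> \<le> 2 * (range_bound * \<delta>)"
      using z(2) mult_left_mono[OF d range_bound_nonneg] by linarith
    also have "\<dots> < \<mu>"
      using \<delta> range_bound_nonneg by (simp add: \<delta>_def field_simps) 
    finally show "emb z \<bullet> u \<le> - w u" using \<mu>_le[OF z(1)] by linarith
  qed
qed

end

section \<open>Seeds and the velocities at which they move\<close>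

locale supercritical_ca = solidifying_ca +
  assumes supercrit: "supercritical N \<pi>d"
begin

lemma speed_pos: "norm u = 1 \<Longrightarrow> 0 < w u"
  using supercrit unfolding supercritical_def by blast

text \<open>Equality in direction u is allowed but not demanded, so points strictly inside L_1 are
  included and the same seeds serve segments on an edge and in the interior.\<close>

definition exposed :: "point \<Rightarrow> point \<Rightarrow> bool" where
  "exposed u y \<longleftrightarrow> y \<bullet> u \<le> w u \<and> (\<forall>v. norm v = 1 \<longrightarrow> v \<noteq> u \<longrightarrow> y \<bullet> v < w v)"

lemma min_speed: obtains r where "r > 0" "\<And>v. norm v = 1 \<Longrightarrow> 2 * r \<le> w v"
proof -
  obtain c where c: "c > 0" "\<And>v. norm v = 1 \<Longrightarrow> c \<le> w v"
    using slack_bound[of UNIV 0] speed_pos by auto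
  show ?thesis by (rule that[of "c / 2"]) (use c in auto)
qed

text \<open>K lives in the plane, not on the lattice, and S may depend on k. The condition is thus
  invariant under real translations, as is needed for blocks whose positions i a + (n - i) b are not
  lattice points.\<close>

definition seed :: "point set \<Rightarrow> point set \<Rightarrow> bool" where
  "seed Y K \<longleftrightarrow> (\<forall>k\<in>K. \<forall>y\<in>Y. \<exists>S\<subseteq>N. \<pi>d S \<and> (\<forall>z\<in>S. k + y + emb z \<in> K))"

text \<open>The chord is long, but subtends a small angle: where it meets the circle, the normals of both
  are so close that the same subset of \<open>N\<close> serves for both.\<close>

lemma seed_exists:
  assumes u: "norm u = 1"
    and m: "\<And>y. y \<in> Y \<Longrightarrow> norm y \<le> m"
    and Yu: "\<And>y. y \<in> Y \<Longrightarrow> y \<bullet> u \<le> w u"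
    and slack: "\<And>\<kappa>. \<kappa> > 0 \<Longrightarrow>
      \<exists>c>0. \<forall>y\<in>Y. \<forall>v. norm v = 1 \<longrightarrow> v \<bullet> u \<le> 1 - \<kappa> \<longrightarrow> y \<bullet> v + c \<le> w v"
  shows "\<exists>K R. R > 0 \<and> cball 0 2 \<subseteq> K \<and> K \<subseteq> cball 0 R \<and> seed Y K"
proof -
  obtain \<kappa>0 where \<kappa>0: "\<kappa>0 > 0" "\<And>v z. norm v = 1 \<Longrightarrow> 1 - \<kappa>0 \<le> v \<bullet> u \<Longrightarrow> z \<in> N \<Longrightarrow>
      emb z \<bullet> v \<le> - w v \<Longrightarrow> emb z \<bullet> u \<le> - w u"
    using speed_set_near[OF u] by blast
  \<comment> \<open>The chord is at height R (1 - \<kappa>). Taking \<kappa> at most half of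
    \<kappa>0 leaves a margin, so that points within m' of the chord and close to the circle still
    have directions in the range of \<open>speed_set_near\<close>.\<close>
  define \<kappa> where "\<kappa> = min (\<kappa>0 / 2) (1 / 2)"
  have \<kappa>: "\<kappa> > 0" "\<kappa> \<le> 1 / 2" "2 * \<kappa> \<le> \<kappa>0" using \<kappa>0(1) by (auto simp: \<kappa>_def)
  obtain c where c: "c > 0"
      "\<And>y v. y \<in> Y \<Longrightarrow> norm v = 1 \<Longrightarrow> v \<bullet> u \<le> 1 - \<kappa> / 2 \<Longrightarrow> y \<bullet> v + c \<le> w v"
    using slack[of "\<kappa> / 2"] \<kappa>(1) by fastforce
  define m' where "m' = \<bar>m\<bar> + range_bound + 1"
  have m': "m' > 0" using range_bound_nonneg by (simp add: m'_def)
  have step: "norm (y + emb z) \<le> m'" if "y \<in> Y" "z \<in> N" for y z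
    using norm_triangle_ineq[of y "emb z"] m[OF that(1)] norm_emb_le[OF that(2)]
    by (simp add: m'_def)
  \<comment> \<open>One summand per requirement: 4 for the ball of radius 2, m' for R > m', 2 m' /
    \<kappa> for a cap of height R \<kappa> at least 2 m', and the last one so that the slack c
    outweighs the second-order term m'^2.\<close>
  define R where "R = 4 + m' + 2 * m' / \<kappa> + m'\<^sup>2 / (2 * c)"
  have pos: "2 * m' / \<kappa> > 0" "m'\<^sup>2 / (2 * c) > 0" using m' \<kappa> c by auto
  have R: "R \<ge> 4" "R > m'" "R \<ge> 2 * m' / \<kappa>" "R - m' \<ge> m'\<^sup>2 / (2 * c)"
    using pos m' by (auto simp: R_def)
  have R1: "2 * m' \<le> R * \<kappa>" using R(3) \<kappa> by (simp add: field_simps)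
  have R2: "m'\<^sup>2 \<le> 2 * c * (R - m')" using R(4) c(1) by (simp add: field_simps)
  define h where "h = R * (1 - \<kappa>)"
  define K where "K = cball 0 R \<inter> {x. x \<bullet> u \<le> h}"
  have cs: "x \<bullet> u \<le> norm x" for x using Cauchy_Schwarz_ineq2[of x u] u by auto
  show ?thesis
  proof (intro exI[of _ K] exI[of _ R] conjI)
    show "R > 0" using R by simp
    have "4 * (1 / 2) \<le> h" unfolding h_def using R(1) \<kappa>(2) by (intro mult_mono) auto
    then show "cball 0 2 \<subseteq> K"
      using R(1) order_trans[OF cs] by (force simp: K_def)
    show "K \<subseteq> cball 0 R" by (simp add: K_def)
    show "seed Y K"
      unfolding seed_def
    proof (intro ballI)
      fix k y assume k: "k \<in> K" and y: "y \<in> Y"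
      have kR: "norm k \<le> R" and ku: "k \<bullet> u \<le> h" using k by (auto simp: K_def)
      show "\<exists>S\<subseteq>N. \<pi>d S \<and> (\<forall>z\<in>S. k + y + emb z \<in> K)"
      proof (cases "norm k \<le> R - m'")
        case True
        show ?thesis
        proof (intro exI[of _ "{z \<in> N. emb z \<bullet> u \<le> - w u}"] conjI ballI)
          fix z assume z: "z \<in> {z \<in> N. emb z \<bullet> u \<le> - w u}"
          have "norm (k + (y + emb z)) \<le> R"
            using norm_triangle_ineq[of k "y + emb z"] step[OF y] z True by fastforce
          moreover have "(k + y + emb z) \<bullet> u \<le> h"
            using z ku Yu[OF y] by (simp add: inner_add_left)
          ultimately show "k + y + emb z \<in> K" by (simp add: K_def add.assoc)
        qed (use rule_speed[OF u] in auto)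
      next
        case False
        define v where "v = k /\<^sub>R norm k"
        have nk: "norm k > 0" using False R(2) by linarith
        have v: "norm v = 1" "k = norm k *\<^sub>R v" using nk by (auto simp: v_def)
        have kv: "k \<bullet> x = norm k * (v \<bullet> x)" for x by (metis v(2) inner_scaleR_left)
        \<comment> \<open>A point below the chord but near the circle must point away from u, since
          the chord cuts off the cap around u; there the slack c is available.\<close>
        have "norm k * (v \<bullet> u) \<le> norm k * (1 - \<kappa> / 2)"
        proof -
          have "norm k * (v \<bullet> u) \<le> h" using ku kv by simp
          also have "h \<le> (R - m') * (1 - \<kappa> / 2)"
          proof -
            have "(R - m') * (1 - \<kappa> / 2) - h = (R * \<kappa> - 2 * m') / 2 + m' * \<kappa> / 2"
              by (simp add: h_def field_simps)
            also have "\<dots> \<ge> 0" using R1 m' \<kappa> by simp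
            finally show ?thesis by simp
          qed
          also have "\<dots> \<le> norm k * (1 - \<kappa> / 2)"
            using False \<kappa> by (intro mult_right_mono) auto
          finally show ?thesis .
        qed
        then have vu: "v \<bullet> u \<le> 1 - \<kappa> / 2" using nk by simp
        show ?thesis
        proof (intro exI[of _ "{z \<in> N. emb z \<bullet> v \<le> - w v}"] conjI ballI)
          fix z assume z: "z \<in> {z \<in> N. emb z \<bullet> v \<le> - w v}"
          let ?s = "y + emb z"
          have sv: "?s \<bullet> v \<le> - c"
            using z c(2)[OF y v(1) vu] by (simp add: inner_add_left)
          have s: "norm ?s \<le> m'" using step y z by blast
          have "(norm (k + ?s))\<^sup>2 = (norm k)\<^sup>2 + 2 * (norm k * (?s \<bullet> v)) + (norm ?s)\<^sup>2"
            using kv[of ?s] by (simp add: power2_norm_eq_inner inner_add_left inner_add_right inner_commute)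
          also have "norm k * (?s \<bullet> v) \<le> (R - m') * (- c)"
          proof -
            have "norm k * (?s \<bullet> v) \<le> norm k * (- c)" using sv by (intro mult_left_mono) auto
            also have "\<dots> \<le> (R - m') * (- c)" using False c(1) by (intro mult_right_mono_neg) auto
            finally show ?thesis .
          qed
          also have "(norm ?s)\<^sup>2 \<le> m'\<^sup>2" using s by (intro power_mono) auto
          finally have "(norm (k + ?s))\<^sup>2 \<le> (norm k)\<^sup>2 + 2 * ((R - m') * (- c)) + m'\<^sup>2" by simp
          also have "2 * ((R - m') * (- c)) = - (2 * c * (R - m'))" by simp
          finally have "(norm (k + ?s))\<^sup>2 \<le> (norm k)\<^sup>2" using R2 by linarith
          then have "norm (k + ?s) \<le> norm k" by (rule power2_le_imp_le) simp
          then have "norm (k + ?s) \<le> R" using kR by simp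
          moreover have "(k + ?s) \<bullet> u \<le> h"
          \<comment> \<open>A point more than m' below the chord cannot cross it in one step.
            Otherwise v is close to u, and the neighbours chosen for v also respect the
            chord.\<close>
          proof (cases "k \<bullet> u \<le> h - m'")
            case True
            then show ?thesis using cs[of ?s] s by (simp add: inner_add_left)
          next
            case False
            have "1 - \<kappa>0 \<le> v \<bullet> u"
            proof (rule ccontr)
              assume "\<not> 1 - \<kappa>0 \<le> v \<bullet> u"
              then have "v \<bullet> u \<le> 1 - 2 * \<kappa>" using \<kappa>(3) by simp
              then have "k \<bullet> u \<le> norm k * (1 - 2 * \<kappa>)" unfolding kv by (intro mult_left_mono) auto
              also have "\<dots> \<le> R * (1 - 2 * \<kappa>)" using kR \<kappa>(2) by (intro mult_right_mono) auto
              also have "\<dots> \<le> h - m'" using R1 m' by (simp add: h_def algebra_simps)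
              finally show False using False by simp
            qed
            then have "emb z \<bullet> u \<le> - w u" using \<kappa>0(2)[OF v(1)] z by blast
            then show ?thesis using ku Yu[OF y] by (simp add: inner_add_left)
          qed
          ultimately show "k + y + emb z \<in> K" by (simp add: K_def add.assoc)
        qed (use rule_speed[OF v(1)] in auto)
      qed
    qed
  qed
qed

text \<open>The ball of small velocities is added so that the sites of a seed fill space on their
  own and may serve as an initial state. The factor 2 in \<open>min_speed\<close> gives these
  velocities slack r in every direction.\<close>

lemma seed_for_pair:
  assumes u: "norm u = 1" and ab: "exposed u a" "exposed u b"
  shows "\<exists>K R r. R > 0 \<and> r > 0 \<and> cball 0 2 \<subseteq> K \<and> K \<subseteq> cball 0 R \<and> seed ({a, b} \<union> cball 0 r) K"
proof -
  obtain r where r: "r > 0" "\<And>v. norm v = 1 \<Longrightarrow> 2 * r \<le> w v"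
    using min_speed by blast
  have le: "y \<bullet> v + r \<le> w v" if "norm v = 1" "norm y \<le> r" for y v
    using r(2)[OF that(1)] Cauchy_Schwarz_ineq2[of y v] that by simp
  let ?Y = "{a, b} \<union> cball 0 r"
  have slack_ab: "\<exists>c>0. \<forall>v. norm v = 1 \<longrightarrow> v \<bullet> u \<le> 1 - \<kappa> \<longrightarrow> y \<bullet> v + c \<le> w v"
    if "\<kappa> > 0" "exposed u y" for \<kappa> y
  proof -
    have "closed {v. v \<bullet> u \<le> 1 - \<kappa>}"
      by (intro closed_Collect_le continuous_intros)
    moreover have "y \<bullet> v < w v" if "v \<in> {v. v \<bullet> u \<le> 1 - \<kappa>}" "norm v = 1" for v
    proof -
      have "v \<noteq> u" using that \<open>\<kappa> > 0\<close> u by (auto simp: norm_eq_1)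
      then show ?thesis using \<open>exposed u y\<close> that by (simp add: exposed_def)
    qed
    ultimately show ?thesis using slack_bound[of "{v. v \<bullet> u \<le> 1 - \<kappa>}" y] by auto
  qed
  have slack: "\<exists>c>0. \<forall>y\<in>?Y. \<forall>v. norm v = 1 \<longrightarrow> v \<bullet> u \<le> 1 - \<kappa> \<longrightarrow> y \<bullet> v + c \<le> w v"
    if \<kappa>: "\<kappa> > 0" for \<kappa>
  proof -
    obtain ca where ca: "ca > 0" "\<And>v. norm v = 1 \<Longrightarrow> v \<bullet> u \<le> 1 - \<kappa> \<Longrightarrow> a \<bullet> v + ca \<le> w v"
      using slack_ab[OF \<kappa> ab(1)] by blast
    obtain cb where cb: "cb > 0" "\<And>v. norm v = 1 \<Longrightarrow> v \<bullet> u \<le> 1 - \<kappa> \<Longrightarrow> b \<bullet> v + cb \<le> w v"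
      using slack_ab[OF \<kappa> ab(2)] by blast
    show ?thesis
    proof (intro exI[of _ "min r (min ca cb)"] conjI ballI allI impI)
      fix y v assume y: "y \<in> ?Y" and v: "norm v = 1" "v \<bullet> u \<le> 1 - \<kappa>"
      have m: "min r (min ca cb) \<le> r" "min r (min ca cb) \<le> ca" "min r (min ca cb) \<le> cb"
        by auto
      consider "y = a" | "y = b" | "norm y \<le> r" using y by auto
      then show "y \<bullet> v + min r (min ca cb) \<le> w v"
      proof cases
        case 1
        show ?thesis unfolding 1 using ca(2)[OF v] m by linarith
      next
        case 2
        show ?thesis unfolding 2 using cb(2)[OF v] m by linarith
      next
        case 3
        then show ?thesis using le[OF v(1)] m by (meson add_left_mono order_trans)
      qed
    qed (use ca cb r in auto)
  qed
  have bound: "norm y \<le> norm a + norm b + r" if "y \<in> ?Y" for y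
    using that r(1) by (auto intro: add_nonneg_nonneg order_trans)
  have "y \<bullet> u \<le> w u" if "y \<in> ?Y" for y
    using that ab le[OF u, of y] r(1) by (auto simp: exposed_def)
  then have "\<exists>K R. R > 0 \<and> cball 0 2 \<subseteq> K \<and> K \<subseteq> cball 0 R \<and> seed ?Y K"
    by (intro seed_exists[OF u bound _ slack])
  then show ?thesis using r(1) by blast
qed

section \<open>Lattice points of seeds and the random dynamics\<close>

definition pts :: "point set \<Rightarrow> point \<Rightarrow> site set" where
  "pts K q = {x. emb x - q \<in> K}"

lemma finite_pts:
  assumes "K \<subseteq> cball 0 R"
  shows "finite (pts K q)"
proof (rule finite_subset[OF _ finite_lattice_ball[of q "nat \<lceil>R\<rceil>"]])
  have "norm k \<le> real (nat \<lceil>R\<rceil>)" if "k \<in> K" for k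
    using that assms real_nat_ceiling_ge[of R] by fastforce
  then show "pts K q \<subseteq> {x. norm (emb x - q) \<le> real (nat \<lceil>R\<rceil>)}"
    unfolding pts_def by blast
qed

lemma ex_rule_set_of_pts:
  assumes "seed Y K" "y \<in> Y" "x \<in> pts K (q + y)"
  shows "\<exists>S\<subseteq>N. \<pi>d S \<and> (\<forall>z\<in>S. x + z \<in> pts K q)"
proof -
  have "emb x - (q + y) \<in> K" using assms(3) by (simp add: pts_def)
  then have "\<exists>S\<subseteq>N. \<pi>d S \<and> (\<forall>z\<in>S. emb x - (q + y) + y + emb z \<in> K)"
    using assms(1,2) unfolding seed_def by blast
  then show ?thesis
    by (auto simp: pts_def emb_add algebra_simps)
qed

lemma fills_space_pts:
  assumes "r > 0" "0 \<in> K" and seed: "seed Y K" "cball 0 r \<subseteq> Y"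
    and sub: "pts K 0 \<subseteq> A"
  shows "fills_space N \<pi>d A"
proof -
  have pts: "pts K (real t *\<^sub>R y) \<subseteq> (ca_step N \<pi>d ^^ t) A" if y: "y \<in> cball 0 r" for y t
  proof (induction t)
    case 0
    then show ?case using sub by simp
  next
    case (Suc t)
    show ?case
    proof
      fix x assume "x \<in> pts K (real (Suc t) *\<^sub>R y)"
      then have "x \<in> pts K (real t *\<^sub>R y + y)" by (simp add: algebra_simps)
      then obtain S where S: "S \<subseteq> N" "\<pi>d S" "\<forall>z\<in>S. x + z \<in> pts K (real t *\<^sub>R y)"
        using ex_rule_set_of_pts[OF seed(1) subsetD[OF seed(2) y]] by blast
      then have "\<pi>d {z \<in> N. x + z \<in> (ca_step N \<pi>d ^^ t) A}"
        using Suc by (intro mono_rule[OF _ _ S(2)]) auto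
      then show "x \<in> (ca_step N \<pi>d ^^ Suc t) A" by (simp add: ca_step_iff)
    qed
  qed
  have "\<exists>t. x \<in> (ca_step N \<pi>d ^^ t) A" for x
  proof -
    \<comment> \<open>The seed is sent towards x with constant velocity
      \<open>emb x /\<^sub>R real t\<close>, slow enough to be admissible, so that its centre is at
      x at time t.\<close>
    obtain t where t: "real t * r > norm (emb x)"
      using reals_Archimedean3[OF assms(1)] by blast
    then have "t > 0" by (cases t) auto
    then have "emb x = real t *\<^sub>R (emb x /\<^sub>R real t)" by simp
    then have "x \<in> pts K (real t *\<^sub>R (emb x /\<^sub>R real t))" using assms(2) by (simp add: pts_def)
    moreover have "emb x /\<^sub>R real t \<in> cball 0 r"
      using t \<open>t > 0\<close> by (simp add: field_simps)
    ultimately show ?thesis using pts by blast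
  qed
  then show ?thesis by (auto simp: fills_space_def)
qed

lemma random_ca_Suc_iff: "x \<in> random_ca N \<pi> A0 \<omega> (Suc t) \<longleftrightarrow>
    \<omega> (t, x) < \<pi> {z \<in> N. x + z \<in> random_ca N \<pi> A0 \<omega> t}"
proof -
  have "(\<lambda>y. y - x) ` ((\<lambda>z. x + z) ` N \<inter> A) = {z \<in> N. x + z \<in> A}" for A
  proof (intro equalityI subsetI)
    fix z assume "z \<in> {z \<in> N. x + z \<in> A}"
    then show "z \<in> (\<lambda>y. y - x) ` ((\<lambda>z. x + z) ` N \<inter> A)"
      by (intro image_eqI[of _ _ "x + z"]) auto
  qed auto
  then show ?thesis by simp
qed

lemma random_ca_SucI:
  assumes "\<omega> (t, x) < p" "p \<le> 1" "S \<subseteq> N" "\<pi>d S"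
    "\<And>z. z \<in> S \<Longrightarrow> x + z \<in> random_ca N (perturbed_rule \<pi>d p) A0 \<omega> t"
  shows "x \<in> random_ca N (perturbed_rule \<pi>d p) A0 \<omega> (Suc t)"
proof -
  have "\<pi>d {z \<in> N. x + z \<in> random_ca N (perturbed_rule \<pi>d p) A0 \<omega> t}"
    by (rule mono_rule[OF _ _ assms(4)]) (use assms in auto)
  then show ?thesis
    unfolding random_ca_Suc_iff using assms(1,2) by (auto simp: perturbed_rule_def)
qed

text \<open>With nonnegative noise a site can join only if the deterministic rule accepts its
  occupied neighbours, and then one of them is at most \<open>w u\<close> behind it. So noise never
  outruns the deterministic half-space speed.\<close>

lemma random_ca_inner_le:
  assumes \<omega>: "\<And>s. 0 \<le> \<omega> s" and u: "norm u = 1" and c: "\<And>x. x \<in> A0 \<Longrightarrow> emb x \<bullet> u \<le> c"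
    and "x \<in> random_ca N (perturbed_rule \<pi>d p) A0 \<omega> t"
  shows "emb x \<bullet> u \<le> c + real t * w u"
  using assms(4)
proof (induction t arbitrary: x)
  case 0
  then show ?case using c by simp
next
  case (Suc t)
  let ?S = "{z \<in> N. x + z \<in> random_ca N (perturbed_rule \<pi>d p) A0 \<omega> t}"
  have "perturbed_rule \<pi>d p ?S > 0"
    using Suc.prems \<omega>[of "(t, x)"] unfolding random_ca_Suc_iff by linarith
  then have "\<pi>d ?S"
    using solidification[of ?S] by (auto simp: perturbed_rule_def split: if_splits)
  then obtain z where z: "z \<in> ?S" "- w u \<le> emb z \<bullet> u"
    using ex_inner_ge_speed[OF u, of ?S] by auto
  then have "emb (x + z) \<bullet> u \<le> c + real t * w u" using Suc.IH by simp
  then show ?case using z(2) by (simp add: emb_add inner_add_left algebra_simps)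
qed

text \<open>The degenerate pair a = b = 0 suffices. Without some finite filling set the convergence
  clause of \<open>asymptotic_shape\<close> would carry no information about L.\<close>

lemma ex_finite_filling: "\<exists>A0. finite A0 \<and> fills_space N \<pi>d A0"
proof -
  define u :: point where "u = (1, 0)"
  have u: "norm u = 1" by (simp add: u_def norm_prod_def)
  have "exposed u 0" using speed_pos u by (auto simp: exposed_def less_imp_le)
  then obtain K R r where K: "R > 0" "r > 0" "cball 0 2 \<subseteq> K" "K \<subseteq> cball 0 R"
    "seed ({0, 0} \<union> cball 0 r) K"
    using seed_for_pair[OF u, of 0 0] by blast
  have "0 \<in> K" using K(3) by auto
  then have "fills_space N \<pi>d (pts K 0)" by (intro fills_space_pts[OF K(2) _ K(5)]) auto
  then show ?thesis using finite_pts[OF K(4)] by blast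
qed

lemma asymptotic_shape_subset:
  assumes L: "asymptotic_shape N \<pi>d p L"
  shows "L \<subseteq> deterministic_shape N \<pi>d"
proof
  fix y assume y: "y \<in> L"
  obtain A0 where A0: "finite A0" "fills_space N \<pi>d A0" using ex_finite_filling by blast
  let ?A = "random_ca N (perturbed_rule \<pi>d p) A0"
  have "AE \<omega> in noise. hausdorff_tendsto (\<lambda>t. (\<lambda>x. (1 / real t) *\<^sub>R emb x) ` ?A \<omega> t) L \<and> (\<forall>s. 0 \<le> \<omega> s)"
    using L A0 AE_noise_nonneg by (auto simp: asymptotic_shape_def)
  then obtain \<omega> where H: "hausdorff_tendsto (\<lambda>t. (\<lambda>x. (1 / real t) *\<^sub>R emb x) ` ?A \<omega> t) L"
    and \<omega>: "\<And>s. 0 \<le> \<omega> s"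
    using eventually_happens'[OF noise.ae_filter_bot] by blast
  have "y \<bullet> u \<le> w u" if u: "norm u = 1" for u
  proof (rule field_le_epsilon)
    fix e :: real assume e: "e > 0"
    define c where "c = Max (insert 0 ((\<lambda>x. emb x \<bullet> u) ` A0))"
    have c: "emb x \<bullet> u \<le> c" if "x \<in> A0" for x unfolding c_def using that A0 by auto
    have "\<forall>\<^sub>F t in sequentially. L \<subseteq> (\<Union>y\<in>(\<lambda>x. (1 / real t) *\<^sub>R emb x) ` ?A \<omega> t. ball y (e / 2))"
      using H e unfolding hausdorff_tendsto_def by (auto elim!: allE[of _ "e / 2"] eventually_mono)
    moreover have "\<forall>\<^sub>F t in sequentially. c / real t < e / 2"
      using e by (intro order_tendstoD(2)[OF lim_const_over_n]) simp
    ultimately have "\<forall>\<^sub>F t in sequentially. t > 0 \<and> c / real t < e / 2 \<and>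
        L \<subseteq> (\<Union>y\<in>(\<lambda>x. (1 / real t) *\<^sub>R emb x) ` ?A \<omega> t. ball y (e / 2))"
      using eventually_gt_at_top[of 0] by eventually_elim auto
    from eventually_happens'[OF sequentially_bot this]
    obtain t where t: "t > 0" "c / real t < e / 2"
        "L \<subseteq> (\<Union>y\<in>(\<lambda>x. (1 / real t) *\<^sub>R emb x) ` ?A \<omega> t. ball y (e / 2))" by blast
    then obtain x where x: "x \<in> ?A \<omega> t" "dist ((1 / real t) *\<^sub>R emb x) y < e / 2"
      using y by auto
    have "y \<bullet> u = (1 / real t) * (emb x \<bullet> u) + (y - (1 / real t) *\<^sub>R emb x) \<bullet> u"
      by (simp add: inner_diff_left)
    also have "(1 / real t) * (emb x \<bullet> u) \<le> (1 / real t) * (c + real t * w u)"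
      using random_ca_inner_le[OF \<omega> u c x(1)] t(1) by (intro mult_left_mono) auto
    also have "\<dots> = c / real t + w u" using t(1) by (simp add: field_simps)
    also have "(y - (1 / real t) *\<^sub>R emb x) \<bullet> u \<le> e / 2"
      using Cauchy_Schwarz_ineq2[of "y - (1 / real t) *\<^sub>R emb x" u] u x(2)
      by (simp add: dist_norm norm_minus_commute)
    finally show "y \<bullet> u \<le> w u + e" using t(2) by linarith
  qed
  then show "y \<in> deterministic_shape N \<pi>d" by (simp add: deterministic_shape_def)
qed

text \<open>Block \<open>j\<close> at time \<open>n\<close> is the seed translated by \<open>j *\<^sub>R a + (n - j) *\<^sub>R b\<close>. Unless some noise
  variable near it is too large, it produces blocks \<open>j\<close> and \<open>j + 1\<close> at time \<open>n + 1\<close>. The percolation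
  argument is applied to time reversed from \<open>n\<close>.\<close>

lemma prob_block_survives:
  assumes ab: "a \<noteq> b" and R: "R > 0" and K: "K \<subseteq> cball 0 R"
    and seed: "seed Y K" "{a, b} \<subseteq> Y"
  shows "\<exists>p0<1. \<forall>p n. p0 < p \<longrightarrow> 0 < p \<longrightarrow> p < 1 \<longrightarrow>
    (\<exists>E\<in>sets noise. 3 / 4 \<le> measure noise E \<and> (\<forall>\<omega>\<in>E. \<exists>j\<in>{0..int n}.
      pts K (real n *\<^sub>R b + real_of_int j *\<^sub>R (a - b)) \<subseteq>
        random_ca N (perturbed_rule \<pi>d p) (pts K 0 \<union> pts K (a - b)) \<omega> n))"
proof -
  define q where "q n j = real n *\<^sub>R b + real_of_int j *\<^sub>R (a - b)" for n :: nat and j :: int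
  \<comment> \<open>Large enough for the ball \<open>B n j\<close> to contain all sites of both
    blocks that block j of time n can produce.\<close>
  define r where "r = nat \<lceil>R + norm a + norm b\<rceil>"
  have r: "R + norm a + norm b \<le> real r" unfolding r_def by (rule real_nat_ceiling_ge)
  define B where "B n j = {x. norm (emb x - q n j) \<le> real r}" for n j
  define V where "V = (2 * r + 2)\<^sup>2"
  have V: "V > 0" by (simp add: V_def)
  obtain d :: nat where d: "real d * norm (a - b) > 2 * real r"
    using reals_Archimedean3[of "norm (a - b)"] ab by auto
  then have d0: "d > 0" by (cases d) auto
  have disj: "B k i \<inter> B k j = {}" if "int d \<le> \<bar>i - j\<bar>" for k i j
  proof (rule ccontr)
    assume "B k i \<inter> B k j \<noteq> {}"
    then obtain x where x: "norm (emb x - q k i) \<le> real r" "norm (emb x - q k j) \<le> real r"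
      by (auto simp: B_def)
    have "q k i - q k j = real_of_int (i - j) *\<^sub>R (a - b)" by (simp add: q_def algebra_simps)
    then have "real_of_int \<bar>i - j\<bar> * norm (a - b) = norm ((emb x - q k j) - (emb x - q k i))"
      by simp
    also have "\<dots> \<le> 2 * real r"
      using norm_triangle_ineq4[of "emb x - q k j" "emb x - q k i"] x by linarith
    also have "\<dots> < real d * norm (a - b)" by (rule d)
    also have "\<dots> \<le> real_of_int \<bar>i - j\<bar> * norm (a - b)"
      using that by (intro mult_right_mono norm_ge_zero) linarith
    finally show False by simp
  qed
  have sub_B: "pts K (q n j + y) \<subseteq> B n j" if "y \<in> {a, b}" for n j y
  proof
    fix x assume "x \<in> pts K (q n j + y)"
    then have "norm (emb x - (q n j + y)) \<le> R" using K by (auto simp: pts_def)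
    moreover have "norm (emb x - q n j) \<le> norm (emb x - (q n j + y)) + norm y"
      using norm_triangle_ineq[of "emb x - (q n j + y)" y] by simp
    moreover have "norm y \<le> norm a + norm b" using that by auto
    ultimately show "x \<in> B n j" using r by (simp add: B_def)
  qed
  have q_Suc: "q (Suc n) j = q n j + b" "q (Suc n) (j + 1) = q n j + a" for n j
    by (simp_all add: q_def algebra_simps)
  \<comment> \<open>\<open>V\<close> bounds the number of noise variables of a block; this p0 makes
    V (1 - p) at most (1/32)^d, where d is the distance of positions at which blocks are
    disjoint.\<close>
  define p0 where "p0 = 1 - (1 / 32) ^ d / real V"
  have "p0 < 1" using V by (simp add: p0_def)
  moreover have "\<exists>E\<in>sets noise. 3 / 4 \<le> measure noise E \<and> (\<forall>\<omega>\<in>E. \<exists>j\<in>{0..int n}.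
      pts K (q n j) \<subseteq> random_ca N (perturbed_rule \<pi>d p) (pts K 0 \<union> pts K (a - b)) \<omega> n)"
    if p: "p0 < p" "0 < p" "p < 1" for p n
  proof -
    let ?A = "random_ca N (perturbed_rule \<pi>d p) (pts K 0 \<union> pts K (a - b))"
    define bad where "bad k j = (if k < n \<and> 0 \<le> j \<and> j \<le> int n
      then {\<omega> :: nat \<times> site \<Rightarrow> real. \<exists>x\<in>B (n - Suc k) j. p \<le> \<omega> (n - Suc k, x)} else {})" for k j
    have fin: "finite (B k j)" for k j
      unfolding B_def by (rule finite_lattice_ball)
    have Vq: "real V * (1 - p) \<le> (1 / 32) ^ d"
      using p(1) V by (simp add: p0_def field_simps)
    interpret P: percolation noise bad n
    proof
      fix k j
      have "{\<omega> \<in> space noise. \<exists>x\<in>B (n - Suc k) j. p \<le> \<omega> (n - Suc k, x)} \<in> sets noise"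
        using fin by measurable
      then show "bad k j \<in> sets noise" by (simp add: bad_def)
      show "bad k j = {}" if "j < 0 \<or> int n < j" using that by (auto simp: bad_def)
    next
      fix S :: "(nat \<times> int) set" assume S: "finite S"
      let ?E = "{\<omega> \<in> space noise. \<forall>(k, j)\<in>S. \<omega> \<in> bad k j}"
      show "measure noise ?E \<le> (1 / 32) ^ card S"
      proof (cases "S \<subseteq> {..<n} \<times> {0..int n}")
        case True
        define S' where "S' = (\<lambda>(k, j). (n - Suc k, j)) ` S"
        have "card S' = card S"
          unfolding S'_def
          by (intro card_image inj_on_subset[OF _ True]) (auto simp: inj_on_def)
        moreover have "?E = {\<omega>. \<forall>(k, j)\<in>S'. \<exists>x\<in>B k j. p \<le> \<omega> (k, x)}"
          using True by (force simp: S'_def bad_def)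
        moreover have "measure noise {\<omega>. \<forall>(k, j)\<in>S'. \<exists>x\<in>B k j. p \<le> \<omega> (k, x)} \<le> (1 / 32) ^ card S'"
        proof (rule prob_all_bad_le[where V = V and d = d])
          show "card (B k j) \<le> V" for k j
            unfolding B_def V_def by (rule card_lattice_ball_le)
        qed (use S p d0 fin disj Vq in \<open>auto simp: S'_def\<close>)
        ultimately show ?thesis by simp
      next
        case False
        then obtain s where s: "s \<in> S" "s \<notin> {..<n} \<times> {0..int n}" by blast
        then have "bad (fst s) (snd s) = {}" by (cases s) (auto simp: bad_def)
        then have empty: "?E = {}" using s(1) by (auto simp: case_prod_beta)
        show ?thesis unfolding empty by simp
      qed
    qed
    \<comment> \<open>Site i of level k stands for the pair of blocks i and i + 1 at time n - k: a
      good block j of the pair produces the pair j, j + 1 one step later. The initial state is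
      accordingly the pair 0, 1. The bound on i keeps all indices in \<open>{0..n}\<close>, where
      \<open>bad\<close> really describes the noise.\<close>
    have survive: "\<exists>j\<in>{0..int n}. pts K (q n j) \<subseteq> ?A \<omega> n"
      if "k \<le> n" "0 \<le> i" "i \<le> int (n - k)" "\<omega> \<notin> P.cut k i"
        "pts K (q (n - k) i) \<subseteq> ?A \<omega> (n - k)" "pts K (q (n - k) (i + 1)) \<subseteq> ?A \<omega> (n - k)" for \<omega> k i
      using that
    proof (induction k arbitrary: i)
      case 0
      then show ?case by auto
    next
      case (Suc k)
      define t where "t = n - Suc k"
      have t: "n - k = Suc t" using Suc.prems(1) by (simp add: t_def)
      have "\<exists>j\<in>{i, i + 1}. \<omega> \<notin> bad k j \<and> \<omega> \<notin> P.cut k j"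
        using Suc.prems(4) by auto
      then obtain j where j: "j \<in> {i, i + 1}" "\<omega> \<notin> bad k j" "\<omega> \<notin> P.cut k j" by blast
      have j_bounds: "0 \<le> j" "j \<le> int (n - k)"
        using j(1) Suc.prems by auto
      have present: "pts K (q t j) \<subseteq> ?A \<omega> t"
        using j(1) Suc.prems(5,6) by (auto simp: t_def)
      have good: "\<omega> (t, x) < p" if "x \<in> B t j" for x
        using j(2) j_bounds Suc.prems(1) that by (auto simp: bad_def t_def not_le)
      have grow: "pts K (q t j + y) \<subseteq> ?A \<omega> (Suc t)" if y: "y \<in> {a, b}" for y
      proof
        fix x assume x: "x \<in> pts K (q t j + y)"
        obtain S where S: "S \<subseteq> N" "\<pi>d S" "\<forall>z\<in>S. x + z \<in> pts K (q t j)"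
          using ex_rule_set_of_pts[OF seed(1) subsetD[OF seed(2) y] x] by blast
        show "x \<in> ?A \<omega> (Suc t)"
          using S present good[OF subsetD[OF sub_B[OF y] x]] p(3) by (intro random_ca_SucI[OF _ _ S(1,2)]) auto
      qed
      show ?case
      proof (rule Suc.IH[OF _ j_bounds j(3)])
        show "pts K (q (n - k) j) \<subseteq> ?A \<omega> (n - k)"
          unfolding t q_Suc(1) by (rule grow) simp
        show "pts K (q (n - k) (j + 1)) \<subseteq> ?A \<omega> (n - k)"
          unfolding t q_Suc(2) by (rule grow) simp
      qed (use Suc.prems(1) in simp)
    qed
    show ?thesis
    proof (intro bexI[of _ "space noise - P.cut n 0"] conjI ballI)
      show "3 / 4 \<le> measure noise (space noise - P.cut n 0)"
        using P.prob_cut_le[of n] by (subst noise.prob_compl) auto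
      show "\<exists>j\<in>{0..int n}. pts K (q n j) \<subseteq> ?A \<omega> n" if "\<omega> \<in> space noise - P.cut n 0" for \<omega>
        using that by (intro survive[of n 0]) (auto simp: q_def)
    qed (rule sets.compl_sets[OF P.cut_events])
  qed
  ultimately show ?thesis unfolding q_def by blast
qed

text \<open>If L missed the segment, compactness would give a positive distance \<delta>. A
  surviving block has a site within 2 of its centre, and the centre divided by n lies on the
  segment; so for large n convergence and survival exclude each other, although survival has
  probability at least 3/4.\<close>

lemma asymptotic_shape_meets_segment:
  assumes u: "norm u = 1" and exp: "exposed u a" "exposed u b" and ab: "a \<noteq> b"
  shows "\<exists>p0<1. \<forall>p L. p0 < p \<longrightarrow> 0 < p \<longrightarrow> p < 1 \<longrightarrow> asymptotic_shape N \<pi>d p L \<longrightarrow>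
    L \<inter> closed_segment a b \<noteq> {}"
proof -
  obtain K R r where K: "R > 0" "r > 0" "cball 0 2 \<subseteq> K" "K \<subseteq> cball 0 R"
    "seed ({a, b} \<union> cball 0 r) K"
    using seed_for_pair[OF u exp] by blast
  define A0 where "A0 = pts K 0 \<union> pts K (a - b)"
  define q where "q n j = real n *\<^sub>R b + real_of_int j *\<^sub>R (a - b)" for n :: nat and j :: int
  have "0 \<in> K" using K(3) by auto
  then have A0: "finite A0" "fills_space N \<pi>d A0"
    unfolding A0_def using finite_pts[OF K(4)] K by (auto intro!: fills_space_pts[OF K(2) _ K(5)])
  obtain p0 where p0: "p0 < 1" and surv: "\<And>p n. p0 < p \<Longrightarrow> 0 < p \<Longrightarrow> p < 1 \<Longrightarrow>
    \<exists>E\<in>sets noise. 3 / 4 \<le> measure noise E \<and> (\<forall>\<omega>\<in>E. \<exists>j\<in>{0..int n}.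
      pts K (q n j) \<subseteq> random_ca N (perturbed_rule \<pi>d p) A0 \<omega> n)"
    using prob_block_survives[OF ab K(1,4,5)] unfolding A0_def q_def by blast
  have "L \<inter> closed_segment a b \<noteq> {}"
    if p: "p0 < p" "0 < p" "p < 1" and L: "asymptotic_shape N \<pi>d p L" for p L
  proof
    assume "L \<inter> closed_segment a b = {}"
    moreover have "compact L" using L by (simp add: asymptotic_shape_def)
    ultimately obtain \<delta> where \<delta>: "\<delta> > 0" "\<And>x y. x \<in> L \<Longrightarrow> y \<in> closed_segment a b \<Longrightarrow> \<delta> \<le> dist x y"
      using separate_compact_closed[of L "closed_segment a b"] by auto
    let ?A = "random_ca N (perturbed_rule \<pi>d p) A0"
    obtain E where E: "\<And>n. E n \<in> sets noise" "\<And>n. 3 / 4 \<le> measure noise (E n)"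
      "\<And>n \<omega>. \<omega> \<in> E n \<Longrightarrow> \<exists>j\<in>{0..int n}. pts K (q n j) \<subseteq> ?A \<omega> n"
      using surv[OF p] by metis
    have "AE \<omega> in noise. hausdorff_tendsto (\<lambda>t. (\<lambda>x. (1 / real t) *\<^sub>R emb x) ` ?A \<omega> t) L"
      using L A0 by (auto simp: asymptotic_shape_def)
    then have "AE \<omega> in noise. \<forall>\<^sub>F n in sequentially. \<omega> \<notin> E n"
    proof eventually_elim
      case (elim \<omega>)
      have "\<forall>\<^sub>F n in sequentially. (\<lambda>x. (1 / real n) *\<^sub>R emb x) ` ?A \<omega> n \<subseteq> (\<Union>y\<in>L. ball y (\<delta> / 2))"
        using elim \<delta>(1) unfolding hausdorff_tendsto_def
        by (auto elim!: allE[of _ "\<delta> / 2"] eventually_mono)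
      moreover have "\<forall>\<^sub>F n in sequentially. 2 / real n < \<delta> / 2"
        using \<delta>(1) by (intro order_tendstoD(2)[OF lim_const_over_n]) simp
      ultimately show ?case using eventually_gt_at_top[of 0]
      proof eventually_elim
        case (elim n)
        show ?case
        proof
          assume "\<omega> \<in> E n"
          then obtain j where j: "j \<in> {0..int n}" "pts K (q n j) \<subseteq> ?A \<omega> n" using E(3) by blast
          obtain x where x: "norm (emb x - q n j) \<le> 2" using ex_lattice_point_near by blast
          then have "x \<in> ?A \<omega> n" using j(2) K(3) by (auto simp: pts_def)
          then obtain y where y: "y \<in> L" "dist y ((1 / real n) *\<^sub>R emb x) < \<delta> / 2"
            using elim(1) by fastforce
          let ?z = "(1 / real n) *\<^sub>R q n j"
          have "?z = (1 - real_of_int j / real n) *\<^sub>R b + (real_of_int j / real n) *\<^sub>R a"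
            using elim(3) by (simp add: q_def algebra_simps scaleR_add_right[symmetric])
          then have "?z \<in> closed_segment b a"
            using j(1) elim(3) by (auto simp: closed_segment_def intro!: exI[of _ "real_of_int j / real n"])
          then have "\<delta> \<le> dist y ?z" using \<delta>(2)[OF y(1)] by (simp add: closed_segment_commute)
          also have "\<dots> \<le> dist y ((1 / real n) *\<^sub>R emb x) + dist ((1 / real n) *\<^sub>R emb x) ?z"
            by (rule dist_triangle)
          also have "dist ((1 / real n) *\<^sub>R emb x) ?z = norm (emb x - q n j) / real n"
            by (simp add: dist_norm scaleR_diff_right[symmetric])
          also have "\<dots> \<le> 2 / real n" using x by (intro divide_right_mono) auto
          finally show False using y(2) elim(2) by simp
        qed
      qed
    qed
    then show False
      using noise.not_AE_eventually_notin[of E "3 / 4"] E(1,2) by auto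
  qed
  then show ?thesis using p0 by blast
qed

end

section \<open>Covering the shape\<close>

lemma collinear_of_orthogonal:
  fixes u v x :: point
  assumes "u \<noteq> 0" "v \<noteq> 0" "v \<bullet> u = 0" "x \<bullet> u = 0"
  shows "\<exists>s. x = s *\<^sub>R v"
proof -
  obtain u1 u2 v1 v2 x1 x2 where [simp]: "u = (u1, u2)" "v = (v1, v2)" "x = (x1, x2)"
    by (cases u; cases v; cases x)
  have eqs: "v1 * u1 + v2 * u2 = 0" "x1 * u1 + x2 * u2 = 0" using assms(3,4) by auto
  have "u1 * (x1 * v2 - x2 * v1) = 0" "u2 * (x1 * v2 - x2 * v1) = 0"
    using eqs by algebra+
  then have "x1 * v2 = x2 * v1" using assms(1) by (auto simp: zero_prod_def)
  then have "v1 * (v1 * x1 + v2 * x2) = x1 * (v1\<^sup>2 + v2\<^sup>2)" "v2 * (v1 * x1 + v2 * x2) = x2 * (v1\<^sup>2 + v2\<^sup>2)"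
    by algebra+
  moreover have "v1\<^sup>2 + v2\<^sup>2 \<noteq> 0" using assms(2) by (auto simp: zero_prod_def sum_power2_eq_zero_iff)
  ultimately show ?thesis
    by (intro exI[of _ "(v1 * x1 + v2 * x2) / (v1\<^sup>2 + v2\<^sup>2)"]) (auto simp: field_simps)
qed

lemma closed_segment_on_line:
  fixes x v :: "'a :: real_vector"
  assumes "y \<in> closed_segment (x + \<alpha> *\<^sub>R v) (x + \<beta> *\<^sub>R v)" "\<alpha> \<le> \<beta>"
  shows "\<exists>s. \<alpha> \<le> s \<and> s \<le> \<beta> \<and> y = x + s *\<^sub>R v"
proof -
  obtain t where t: "0 \<le> t" "t \<le> 1" "y = (1 - t) *\<^sub>R (x + \<alpha> *\<^sub>R v) + t *\<^sub>R (x + \<beta> *\<^sub>R v)"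
    using assms(1) unfolding closed_segment_def by blast
  have "y = x + ((1 - t) * \<alpha> + t * \<beta>) *\<^sub>R v"
    unfolding t(3) by (simp add: algebra_simps)
  moreover have "\<alpha> \<le> (1 - t) * \<alpha> + t * \<beta>" "(1 - t) * \<alpha> + t * \<beta> \<le> \<beta>"
    using mult_left_mono[OF assms(2) t(1)] mult_left_mono[OF assms(2), of "1 - t"] t(2)
    by (simp_all add: algebra_simps)
  ultimately show ?thesis by blast
qed

context supercritical_ca
begin

abbreviation "shape1 \<equiv> deterministic_shape N \<pi>d"

lemma deterministic_shape_eq: "shape1 = (\<Inter>u\<in>{u. norm u = 1}. {x. x \<bullet> u \<le> w u})"
  by (auto simp: deterministic_shape_def)

lemma closed_deterministic_shape: "closed shape1"
  unfolding deterministic_shape_eq by (intro closed_INT ballI closed_Collect_le continuous_intros)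

lemma norm_le_of_deterministic_shape: "x \<in> shape1 \<Longrightarrow> norm x \<le> range_bound"
proof (cases "x = 0")
  case False
  assume "x \<in> shape1"
  have n: "norm (x /\<^sub>R norm x) = 1" using False by simp
  have "norm x = x \<bullet> (x /\<^sub>R norm x)"
    using False by (simp add: power2_norm_eq_inner[symmetric] power2_eq_square)
  also have "\<dots> \<le> w (x /\<^sub>R norm x)"
    using \<open>x \<in> shape1\<close> n unfolding deterministic_shape_def by blast
  also have "\<dots> \<le> range_bound" by (rule speed_le_range[OF n])
  finally show ?thesis .
qed (simp add: range_bound_nonneg)

lemma compact_deterministic_shape: "compact shape1"
  using closed_deterministic_shape norm_le_of_deterministic_shape
  unfolding compact_eq_bounded_closed bounded_iff by blast

section \<open>From segments met by the shape to neighbourhoods contained in it\<close>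

definition covered :: "point set \<Rightarrow> bool" where
  "covered A \<longleftrightarrow> (\<exists>p0<1. \<forall>p L. p0 < p \<longrightarrow> 0 < p \<longrightarrow> p < 1 \<longrightarrow>
    asymptotic_shape N \<pi>d p L \<longrightarrow> A \<subseteq> L)"

definition hit :: "point set \<Rightarrow> bool" where
  "hit A \<longleftrightarrow> (\<exists>p0<1. \<forall>p L. p0 < p \<longrightarrow> 0 < p \<longrightarrow> p < 1 \<longrightarrow>
    asymptotic_shape N \<pi>d p L \<longrightarrow> L \<inter> A \<noteq> {})"

lemma hit_segment:
  "norm u = 1 \<Longrightarrow> exposed u a \<Longrightarrow> exposed u b \<Longrightarrow> a \<noteq> b \<Longrightarrow> hit (closed_segment a b)"
  unfolding hit_def by (rule asymptotic_shape_meets_segment)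

text \<open>Finitely many thresholds below 1 have a maximum below 1. What remains to be checked is
  plain geometry of a compact convex set that meets finitely many given sets.\<close>

lemma coveredI:
  assumes "finite F" and hit: "\<And>A. A \<in> F \<Longrightarrow> hit A"
    and cover: "\<And>L. compact L \<Longrightarrow> convex L \<Longrightarrow> (\<And>A. A \<in> F \<Longrightarrow> L \<inter> A \<noteq> {}) \<Longrightarrow>
      B \<subseteq> L"
  shows "covered B"
proof -
  obtain f where f: "\<And>A. A \<in> F \<Longrightarrow> f A < 1" "\<And>A p L. A \<in> F \<Longrightarrow> f A < p \<Longrightarrow> 0 < p \<Longrightarrow> p < 1 \<Longrightarrow>
      asymptotic_shape N \<pi>d p L \<Longrightarrow> L \<inter> A \<noteq> {}"
    using hit unfolding hit_def by metis
  define p0 where "p0 = Max (insert 0 (f ` F))"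
  have "p0 < 1" unfolding p0_def using assms(1) f(1) by (subst Max_less_iff) auto
  moreover have "B \<subseteq> L" if "p0 < p" "0 < p" "p < 1" "asymptotic_shape N \<pi>d p L" for p L
  proof (rule cover)
    show "L \<inter> A \<noteq> {}" if A: "A \<in> F" for A
    proof (rule f(2)[OF A _ \<open>0 < p\<close> \<open>p < 1\<close> \<open>asymptotic_shape N \<pi>d p L\<close>])
      have "f A \<le> p0" unfolding p0_def using A assms(1) by (intro Max_ge) auto
      then show "f A < p" using \<open>p0 < p\<close> by simp
    qed
  qed (use that in \<open>auto simp: asymptotic_shape_def\<close>)
  ultimately show ?thesis unfolding covered_def by blast
qed

lemma exposed_of_slack: "(\<And>v. norm v = 1 \<Longrightarrow> y \<bullet> v < w v) \<Longrightarrow> norm u = 1 \<Longrightarrow> exposed u y"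
  by (auto simp: exposed_def less_imp_le)

text \<open>L meets four short segments near the corners of a square around x. A hyperplane
  separating a nearby point from L would have one of these segments entirely on the wrong
  side.\<close>

lemma covered_near_interior_point:
  assumes x: "\<And>v. norm v = 1 \<Longrightarrow> x \<bullet> v < w v"
  shows "\<exists>\<delta>>0. covered (shape1 \<inter> ball x \<delta>)"
proof -
  obtain c where c: "c > 0" "\<And>v. norm v = 1 \<Longrightarrow> x \<bullet> v + c \<le> w v"
    using slack_bound[of UNIV x] x by auto
  \<comment> \<open>The segments stay within 2 \<rho> + \<rho> / 4 of x, which is less than 4 \<rho>
    = c, so the slack at x keeps them in the interior.\<close>
  define \<rho> where "\<rho> = c / 4"
  have \<rho>: "\<rho> > 0" using c by (simp add: \<rho>_def)
  have inner: "y \<bullet> v < w v" if "norm (y - x) < c" "norm v = 1" for y v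
  proof -
    have "y \<bullet> v = x \<bullet> v + (y - x) \<bullet> v" by (simp add: inner_diff_left)
    also have "(y - x) \<bullet> v < c"
      using Cauchy_Schwarz_ineq2[of "y - x" v] that by simp
    finally show ?thesis using c(2)[OF that(2)] by simp
  qed
  define e :: point where "e = (1, 0)"
  have e: "norm e = 1" by (simp add: e_def norm_prod_def)
  define k where "k s = x + \<rho> *\<^sub>R s" for s :: point
  define I where "I s = closed_segment (k s) (k s + (\<rho> / 4) *\<^sub>R e)" for s
  have hit: "hit (I s)" if "s \<in> {-1, 1} \<times> {-1, 1}" for s
  proof -
    have "norm s \<le> 2"
      using that norm_Pair_le[of "fst s" "snd s"] by auto
    then have n: "norm (\<rho> *\<^sub>R s) \<le> 2 * \<rho>" using \<rho> by simp
    then have n1: "norm (k s - x) < c" using \<rho> by (simp add: k_def \<rho>_def)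
    have "norm ((\<rho> / 4) *\<^sub>R e) = \<rho> / 4" using e \<rho> by simp
    then have "norm (\<rho> *\<^sub>R s + (\<rho> / 4) *\<^sub>R e) \<le> 2 * \<rho> + \<rho> / 4"
      using norm_triangle_ineq[of "\<rho> *\<^sub>R s" "(\<rho> / 4) *\<^sub>R e"] n by linarith
    then have n2: "norm (k s + (\<rho> / 4) *\<^sub>R e - x) < c"
      using \<rho> by (simp add: k_def \<rho>_def add_ac)
    have "e \<noteq> 0" using e by auto
    then show ?thesis
      unfolding I_def using inner[OF n1] inner[OF n2] \<rho>
      by (intro hit_segment[OF e] exposed_of_slack e) auto
  qed
  have "covered (shape1 \<inter> ball x (\<rho> / 4))"
  proof (rule coveredI[of "I ` ({-1, 1} \<times> {-1, 1})"])
    fix L :: "point set" assume L: "compact L" "convex L"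
      and meets: "\<And>A. A \<in> I ` ({-1, 1} \<times> {-1, 1}) \<Longrightarrow> L \<inter> A \<noteq> {}"
    show "shape1 \<inter> ball x (\<rho> / 4) \<subseteq> L"
    proof (rule ccontr)
      assume "\<not> ?thesis"
      then obtain y where y: "y \<in> ball x (\<rho> / 4)" "y \<notin> L" by blast
      obtain d b where d: "d \<bullet> y < b" "\<And>z. z \<in> L \<Longrightarrow> b < d \<bullet> z"
        using separating_hyperplane_closed_point[OF L(2) compact_imp_closed[OF L(1)] y(2)] by blast
      \<comment> \<open>The corner whose signs oppose those of d: <d, s> is minus the l1 norm of d,
        and the errors \<rho> / 4 from the segment and from y cannot compensate this.\<close>
      define s :: point where "s = (if fst d \<ge> 0 then -1 else 1, if snd d \<ge> 0 then -1 else 1)"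
      have "s \<in> {-1, 1} \<times> {-1, 1}" by (simp add: s_def)
      then obtain z where z: "z \<in> L" "z \<in> I s" using meets by blast
      obtain \<theta> where \<theta>: "0 \<le> \<theta>" "\<theta> \<le> 1" "z = (1 - \<theta>) *\<^sub>R k s + \<theta> *\<^sub>R (k s + (\<rho> / 4) *\<^sub>R e)"
        using z(2) unfolding I_def closed_segment_def by blast
      have z_eq: "z = x + \<rho> *\<^sub>R s + (\<theta> * \<rho> / 4) *\<^sub>R e"
        unfolding \<theta>(3) k_def by (simp add: algebra_simps)
      have ds: "d \<bullet> s = - (\<bar>fst d\<bar> + \<bar>snd d\<bar>)" and de: "d \<bullet> e = fst d"
        by (cases d; simp add: s_def e_def abs_if)+
      have "d \<bullet> z = d \<bullet> x - \<rho> * (\<bar>fst d\<bar> + \<bar>snd d\<bar>) + \<theta> * \<rho> / 4 * fst d"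
        unfolding z_eq by (simp add: inner_add_right ds de algebra_simps)
      moreover have "\<theta> * \<rho> / 4 * fst d \<le> \<rho> / 4 * (\<bar>fst d\<bar> + \<bar>snd d\<bar>)"
      proof -
        have "\<theta> * \<rho> / 4 * fst d \<le> \<theta> * \<rho> / 4 * \<bar>fst d\<bar>"
          using \<theta> \<rho> by (intro mult_left_mono) auto
        also have "\<dots> \<le> \<rho> / 4 * (\<bar>fst d\<bar> + \<bar>snd d\<bar>)"
          using \<theta> \<rho> by (intro mult_mono) auto
        finally show ?thesis .
      qed
      moreover have "d \<bullet> x - \<rho> / 4 * (\<bar>fst d\<bar> + \<bar>snd d\<bar>) \<le> d \<bullet> y"
      proof -
        have "d \<bullet> (x - y) \<le> norm d * norm (x - y)"
          using Cauchy_Schwarz_ineq2[of d "x - y"] by simp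
        also have "\<dots> \<le> (\<bar>fst d\<bar> + \<bar>snd d\<bar>) * (\<rho> / 4)"
          using y(1) norm_Pair_le[of "fst d" "snd d"]
          by (intro mult_mono) (auto simp: dist_norm)
        finally show ?thesis by (simp add: inner_diff_right mult.commute)
      qed
      moreover have "0 \<le> \<rho> * (\<bar>fst d\<bar> + \<bar>snd d\<bar>)" using \<rho> by simp
      ultimately have "d \<bullet> z \<le> d \<bullet> y" by linarith
      then show False using d(1) d(2)[OF z(1)] by linarith
    qed
  qed (use hit in auto)
  then show ?thesis using \<rho> by (intro exI[of _ "\<rho> / 4"]) auto
qed

text \<open>L contains points p1, p2 of the edge on either side of x, and a point p3 near the
  origin. The triangle they span contains all points of L_1 close to x: such a y is projected from
  p3 onto the edge and lands between p1 and p2.\<close>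

lemma covered_near_edge_point:
  assumes x: "x1 \<in> shape1" "x2 \<in> shape1" "x \<in> open_segment x1 x2"
    and u: "norm u = 1" "x \<bullet> u = w u"
  shows "\<exists>\<delta>>0. covered (shape1 \<inter> ball x \<delta>)"
proof -
  obtain \<theta> where \<theta>: "0 < \<theta>" "\<theta> < 1" "x = (1 - \<theta>) *\<^sub>R x1 + \<theta> *\<^sub>R x2" and "x1 \<noteq> x2"
    using x(3) by (auto simp: in_segment)
  define v where "v = x2 - x1"
  have v: "v \<noteq> 0" using \<open>x1 \<noteq> x2\<close> by (simp add: v_def)
  have u0: "u \<noteq> 0" using u(1) by auto
  have le: "x1 \<bullet> v' \<le> w v'" "x2 \<bullet> v' \<le> w v'" if "norm v' = 1" for v'
    using x(1,2) that unfolding deterministic_shape_def by blast+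
  have x_v: "x = x1 + \<theta> *\<^sub>R v" "x = x2 - (1 - \<theta>) *\<^sub>R v"
    using \<theta>(3) by (simp_all add: v_def algebra_simps)
  have x_inner: "x \<bullet> y = x1 \<bullet> y + \<theta> * (v \<bullet> y)" "x \<bullet> y = x2 \<bullet> y - (1 - \<theta>) * (v \<bullet> y)" for y
    by (subst x_v(1), simp add: inner_add_left) (subst x_v(2), simp add: inner_diff_left)
  have vu: "v \<bullet> u = 0"
  proof -
    have "\<theta> * (v \<bullet> u) \<ge> 0" "(1 - \<theta>) * (v \<bullet> u) \<le> 0"
      using le[OF u(1)] u(2) x_inner[of u] by linarith+
    then show ?thesis using \<theta>(1,2) by (simp add: zero_le_mult_iff mult_le_0_iff)
  qed
  \<comment> \<open>With a third of the shorter part, both segments, reaching up to 2 s0 from x,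
    stay strictly inside the open segment from x1 to x2.\<close>
  define s0 where "s0 = min \<theta> (1 - \<theta>) / 3"
  have s0: "s0 > 0" "3 * s0 \<le> \<theta>" "3 * s0 \<le> 1 - \<theta>" using \<theta> by (auto simp: s0_def)
  have exp: "exposed u (x + s *\<^sub>R v)" if s: "\<bar>s\<bar> \<le> 2 * s0" for s
    unfolding exposed_def
  proof (intro conjI allI impI)
    show "(x + s *\<^sub>R v) \<bullet> u \<le> w u" using vu u(2) by (simp add: inner_add_left)
    fix v' :: point assume v': "norm v' = 1" "v' \<noteq> u"
    have s': "- \<theta> < s" "s < 1 - \<theta>" using s s0 by linarith+
    have eq: "(x + s *\<^sub>R v) \<bullet> v' = x1 \<bullet> v' + (s + \<theta>) * (v \<bullet> v')"
      "(x + s *\<^sub>R v) \<bullet> v' = x2 \<bullet> v' - (1 - \<theta> - s) * (v \<bullet> v')"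
      using x_inner[of v'] by (simp_all add: inner_add_left algebra_simps)
    consider "v \<bullet> v' > 0" | "v \<bullet> v' < 0" | "v \<bullet> v' = 0" by linarith
    then show "(x + s *\<^sub>R v) \<bullet> v' < w v'"
    proof cases
      case 1
      then have "(1 - \<theta> - s) * (v \<bullet> v') > 0" using s' by simp
      then show ?thesis using eq(2) le(2)[OF v'(1)] by linarith
    next
      case 2
      then have "(s + \<theta>) * (v \<bullet> v') < 0" using s' by (simp add: mult_less_0_iff)
      then show ?thesis using eq(1) le(1)[OF v'(1)] by linarith
    next
      case 3
      \<comment> \<open>A unit vector other than u that is orthogonal to the edge can only be -u,
        where positivity of both speeds gives strictness.\<close>
      then obtain t where t: "v' = t *\<^sub>R u"
        using collinear_of_orthogonal[of v u v'] v u0 vu by (auto simp: inner_commute)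
      then have "t = -1" using v' u(1) by (auto simp: abs_if split: if_splits)
      then have "(x + s *\<^sub>R v) \<bullet> v' = - w u" using t vu u(2) by (simp add: inner_add_left)
      then show ?thesis using speed_pos[OF u(1)] speed_pos[OF v'(1)] by linarith
    qed
  qed
  obtain r where r: "r > 0" "\<And>v. norm v = 1 \<Longrightarrow> 2 * r \<le> w v" using min_speed by blast
  have in_lt: "y \<bullet> v' \<le> w v' - r" if "norm y \<le> r" "norm v' = 1" for y v' :: point
    using Cauchy_Schwarz_ineq2[of y v'] that r(2)[OF that(2)] by simp
  define e where "e = r *\<^sub>R u"
  have e: "norm e = r" "e \<noteq> 0" using r(1) u(1) by (auto simp: e_def)
  define I1 where "I1 = closed_segment (x + (- (2 * s0)) *\<^sub>R v) (x + (- s0) *\<^sub>R v)"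
  define I2 where "I2 = closed_segment (x + s0 *\<^sub>R v) (x + (2 * s0) *\<^sub>R v)"
  define I3 where "I3 = closed_segment 0 e"
  have hits: "hit I1" "hit I2" "hit I3"
  proof -
    have hit_vs: "hit (closed_segment (x + s *\<^sub>R v) (x + t *\<^sub>R v))"
      if "\<bar>s\<bar> \<le> 2 * s0" "\<bar>t\<bar> \<le> 2 * s0" "s \<noteq> t" for s t
      using that v by (intro hit_segment[OF u(1)] exp) auto
    show "hit I1" unfolding I1_def by (rule hit_vs) (use s0 in auto)
    show "hit I2" unfolding I2_def by (rule hit_vs) (use s0 in auto)
    show "hit I3" unfolding I3_def
    proof (rule hit_segment[OF u(1)])
      have "exposed u y" if "norm y \<le> r" for y
        using in_lt[OF that] r(1) u(1) by (intro exposed_of_slack) fastforce+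
      then show "exposed u 0" "exposed u e" using e r(1) by simp_all
    qed (use e in auto)
  qed
  define D where "D = range_bound + r"
  \<comment> \<open>The bound r / 2 keeps y at least r / 2 above p3 in direction u. The other term
    limits the projected point to distance s0 |v| from x, since projecting magnifies |y - x| by at
    most 2 (D + r) / r.\<close>
  define \<delta> where "\<delta> = min (r / 2) (s0 * norm v * r / (2 * (D + r)))"
  have D: "D > 0" using r(1) range_bound_nonneg by (simp add: D_def)
  have \<delta>: "\<delta> > 0" using r(1) s0 v D by (simp add: \<delta>_def)
  have "covered (shape1 \<inter> ball x \<delta>)"
  proof (rule coveredI[of "{I1, I2, I3}"])
    fix L :: "point set" assume L: "compact L" "convex L"
      and meets: "\<And>A. A \<in> {I1, I2, I3} \<Longrightarrow> L \<inter> A \<noteq> {}"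
    obtain p1 where p1: "p1 \<in> L" "p1 \<in> I1" using meets[of I1] by auto
    obtain p2 where p2: "p2 \<in> L" "p2 \<in> I2" using meets[of I2] by auto
    obtain p3 where p3: "p3 \<in> L" "p3 \<in> I3" using meets[of I3] by auto
    obtain s1 where s1: "s1 \<le> - s0" "p1 = x + s1 *\<^sub>R v"
      using closed_segment_on_line[OF p1(2)[unfolded I1_def]] s0(1) by auto
    obtain s2 where s2: "s0 \<le> s2" "p2 = x + s2 *\<^sub>R v"
      using closed_segment_on_line[OF p2(2)[unfolded I2_def]] s0(1) by auto
    have p3': "norm p3 \<le> r"
      using p3(2) e(1) segment_bound1[of p3 0 e] unfolding I3_def by simp
    show "shape1 \<inter> ball x \<delta> \<subseteq> L"
    proof
      fix y assume "y \<in> shape1 \<inter> ball x \<delta>"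
      then have y: "y \<in> shape1" "norm (y - x) < \<delta>" by (auto simp: dist_norm norm_minus_commute)
      have yu: "y \<bullet> u \<le> w u" using y(1) u(1) unfolding deterministic_shape_def by blast
      have "(x - y) \<bullet> u \<le> norm (x - y)"
        using Cauchy_Schwarz_ineq2[of "x - y" u] u(1) by simp
      then have \<tau>: "w u - y \<bullet> u \<le> norm (y - x)"
        using u(2) by (simp add: inner_diff_left norm_minus_commute)
      have gap: "(y - p3) \<bullet> u \<ge> r / 2"
      proof -
        have "p3 \<bullet> u \<le> w u - r" using in_lt[OF p3' u(1)] .
        moreover have "norm (y - x) \<le> r / 2" using y(2) by (simp add: \<delta>_def)
        ultimately show ?thesis using \<tau> by (simp add: inner_diff_left)
      qed
      \<comment> \<open>Chosen so that the ray from p3 through y reaches the supporting line at q;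
        then y divides the segment from q to p3 with weight \<mu> / (1 + \<mu>) on p3.\<close>
      define \<mu> where "\<mu> = (w u - y \<bullet> u) / ((y - p3) \<bullet> u)"
      have \<mu>0: "\<mu> \<ge> 0" using yu gap r(1) by (simp add: \<mu>_def)
      define q where "q = y + \<mu> *\<^sub>R (y - p3)"
      have qu: "q \<bullet> u = w u"
        using gap r(1) by (simp add: q_def inner_add_left \<mu>_def)
      then obtain s where s: "q - x = s *\<^sub>R v"
        using collinear_of_orthogonal[of u v "q - x"] v u0 u(2) vu by (auto simp: inner_diff_left)
      have "\<bar>s\<bar> * norm v = norm (q - x)" using s by simp
      also have "q - x = (y - x) + \<mu> *\<^sub>R (y - p3)" by (simp add: q_def)
      also have "norm \<dots> \<le> norm (y - x) + \<mu> * norm (y - p3)"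
        using norm_triangle_ineq[of "y - x" "\<mu> *\<^sub>R (y - p3)"] \<mu>0 by simp
      also have "\<mu> * norm (y - p3) \<le> (norm (y - x) / (r / 2)) * D"
      proof (rule mult_mono)
        show "\<mu> \<le> norm (y - x) / (r / 2)"
          unfolding \<mu>_def using \<tau> gap r(1) by (intro frac_le) auto
        show "norm (y - p3) \<le> D"
          using norm_triangle_ineq4[of y p3] norm_le_of_deterministic_shape[OF y(1)] p3'
          by (simp add: D_def)
      qed (use r(1) in auto)
      also have "norm (y - x) + (norm (y - x) / (r / 2)) * D \<le> norm (y - x) * (2 * (D + r) / r)"
        using r(1) D by (simp add: field_simps)
      also have "\<dots> \<le> \<delta> * (2 * (D + r) / r)"
        using y(2) D r(1) by (intro mult_right_mono) auto
      also have "\<dots> \<le> (s0 * norm v * r / (2 * (D + r))) * (2 * (D + r) / r)"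
        using D r(1) by (intro mult_right_mono) (auto simp: \<delta>_def)
      also have "\<dots> = s0 * norm v"
      proof -
        have "(c * r / (2 * d)) * (2 * d / r) = c" if "d \<noteq> 0" for c d
          using that r(1) by simp
        then show ?thesis using D r(1) by simp
      qed
      finally have s_le: "\<bar>s\<bar> \<le> s0" using v by simp
      have "q \<in> L"
      proof -
        define t where "t = (s - s1) / (s2 - s1)"
        have t: "0 \<le> t" "t \<le> 1" using s_le s1(1) s2(1) s0(1) by (auto simp: t_def)
        have "t * (s2 - s1) = s - s1" using s1(1) s2(1) s0(1) by (simp add: t_def)
        then have "s = (1 - t) * s1 + t * s2" by (simp add: algebra_simps)
        then have "q = x + ((1 - t) * s1 + t * s2) *\<^sub>R v"
          using s by (metis add_diff_cancel_left' diff_add_cancel add.commute)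
        also have "\<dots> = (1 - t) *\<^sub>R p1 + t *\<^sub>R p2"
          by (simp add: s1(2) s2(2) algebra_simps)
        finally show ?thesis using convexD_alt[OF L(2) p1(1) p2(1) t] by simp
      qed
      have "q + \<mu> *\<^sub>R p3 = (1 + \<mu>) *\<^sub>R y" by (simp add: q_def algebra_simps)
      then have "(1 / (1 + \<mu>)) *\<^sub>R (q + \<mu> *\<^sub>R p3) = y" using \<mu>0 by simp
      then have "y = (1 / (1 + \<mu>)) *\<^sub>R q + (\<mu> / (1 + \<mu>)) *\<^sub>R p3"
        by (simp add: scaleR_add_right)
      moreover have "1 / (1 + \<mu>) = 1 - \<mu> / (1 + \<mu>)" using \<mu>0 by (simp add: field_simps)
      ultimately have "y = (1 - \<mu> / (1 + \<mu>)) *\<^sub>R q + (\<mu> / (1 + \<mu>)) *\<^sub>R p3"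
        by simp
      then show "y \<in> L"
        using convexD_alt[OF L(2) \<open>q \<in> L\<close> p3(1), of "\<mu> / (1 + \<mu>)"] \<mu>0 by simp
    qed
  qed (use hits in auto)
  then show ?thesis using \<delta> by blast
qed

text \<open>Either all half-space constraints are strict at x, or one is tight; in the tight case
  failure of extremality supplies the segment of L_1 around x that plays the role of the
  edge.\<close>

lemma covered_near_nonextreme_point:
  assumes x: "x \<in> shape1" "\<not> x extreme_point_of shape1"
  shows "\<exists>\<delta>>0. covered (shape1 \<inter> ball x \<delta>)"
proof (cases "\<forall>v. norm v = 1 \<longrightarrow> x \<bullet> v < w v")
  case True
  then show ?thesis by (intro covered_near_interior_point) auto
next
  case False
  then obtain u where u: "norm u = 1" "\<not> x \<bullet> u < w u" by blast
  moreover have "x \<bullet> u \<le> w u"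
    using x(1) u(1) unfolding deterministic_shape_def by blast
  ultimately have "x \<bullet> u = w u" by linarith
  moreover obtain x1 x2 where "x1 \<in> shape1" "x2 \<in> shape1" "x \<in> open_segment x1 x2"
    using x unfolding extreme_point_of_def by blast
  ultimately show ?thesis using covered_near_edge_point[of x1 x2 x u] u(1) by blast
qed

lemma covered_compact:
  assumes K: "compact K" "K \<subseteq> shape1" and local: "\<And>x. x \<in> K \<Longrightarrow> \<exists>\<delta>>0. covered (shape1 \<inter> ball x \<delta>)"
  shows "covered K"
proof -
  obtain \<delta> where \<delta>: "\<And>x. x \<in> K \<Longrightarrow> \<delta> x > 0" "\<And>x. x \<in> K \<Longrightarrow> covered (shape1 \<inter> ball x (\<delta> x))"
    using local by metis
  obtain F where F: "F \<subseteq> K" "finite F" "K \<subseteq> (\<Union>x\<in>F. ball x (\<delta> x))"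
    using compactE_image[OF K(1), of K "\<lambda>x. ball x (\<delta> x)"] \<delta>(1) by force
  obtain f where f: "\<And>x. x \<in> F \<Longrightarrow> f x < 1" "\<And>x p L. x \<in> F \<Longrightarrow> f x < p \<Longrightarrow> 0 < p \<Longrightarrow> p < 1 \<Longrightarrow>
      asymptotic_shape N \<pi>d p L \<Longrightarrow> shape1 \<inter> ball x (\<delta> x) \<subseteq> L"
    using \<delta>(2) F(1) unfolding covered_def by (metis subsetD)
  define p0 where "p0 = Max (insert 0 (f ` F))"
  have "p0 < 1" unfolding p0_def using F(2) f(1) by (subst Max_less_iff) auto
  moreover have "K \<subseteq> L" if p: "p0 < p" "0 < p" "p < 1" "asymptotic_shape N \<pi>d p L" for p L
  proof
    fix y assume y: "y \<in> K"
    then obtain x where x: "x \<in> F" "y \<in> ball x (\<delta> x)" using F(3) by blast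
    have "f x \<le> p0" unfolding p0_def using x F(2) by (intro Max_ge) auto
    then have "shape1 \<inter> ball x (\<delta> x) \<subseteq> L" using f(2)[OF x(1) _ p(2-4)] p(1) by simp
    then show "y \<in> L" using x(2) y K(2) by blast
  qed
  ultimately show ?thesis unfolding covered_def by blast
qed

end

theorem proposition1p2:
  fixes N :: "site set" and \<pi>d :: "site set \<Rightarrow> bool" and L :: "real \<Rightarrow> point set"
  assumes "ca_rule N \<pi>d"
    and "supercritical N \<pi>d"
    and "locally_regular N \<pi>d"
    and "\<And>p. 0 < p \<Longrightarrow> p < 1 \<Longrightarrow> asymptotic_shape N \<pi>d p (L p)"
  shows "\<forall>\<epsilon>>0. \<exists>p. 0 < p \<and> p < 1 \<and>
           agree_outside (\<Union>c\<in>corners (deterministic_shape N \<pi>d). ball c \<epsilon>)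
             (L p) (deterministic_shape N \<pi>d)"
proof (intro allI impI)
  fix \<epsilon> :: real assume \<epsilon>: "\<epsilon> > 0"
  interpret supercritical_ca N \<pi>d
    using assms(1,2) by unfold_locales
  let ?U = "\<Union>c\<in>corners shape1. ball c \<epsilon>"
  have "covered (shape1 - ?U)"
  proof (rule covered_compact)
    show "compact (shape1 - ?U)"
      by (intro compact_diff compact_deterministic_shape open_UN) auto
    fix x assume x: "x \<in> shape1 - ?U"
    then have "x \<notin> corners shape1" using \<epsilon> by (metis DiffD2 UN_I centre_in_ball)
    then show "\<exists>\<delta>>0. covered (shape1 \<inter> ball x \<delta>)"
      using x by (intro covered_near_nonextreme_point) (auto simp: corners_def)
  qed auto
  then obtain p0 where p0: "p0 < 1" "\<And>p L. p0 < p \<Longrightarrow> 0 < p \<Longrightarrow> p < 1 \<Longrightarrow>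
      asymptotic_shape N \<pi>d p L \<Longrightarrow> shape1 - ?U \<subseteq> L"
    unfolding covered_def by blast
  obtain p where p: "max p0 0 < p" "p < 1"
    using dense[of "max p0 0" 1] p0(1) by auto
  then have "asymptotic_shape N \<pi>d p (L p)" using assms(4) by simp
  \<comment> \<open>Since L_p never leaves L_1, agreement outside the neighbourhood reduces to the
    covering statement.\<close>
  then have "shape1 - ?U \<subseteq> L p" "L p \<subseteq> shape1"
    using p0(2)[of p "L p"] asymptotic_shape_subset p by auto
  then show "\<exists>p. 0 < p \<and> p < 1 \<and> agree_outside ?U (L p) shape1"
    using p by (intro exI[of _ p]) (auto simp: agree_outside_def)
qed

end
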